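(* Let $0<\rho_0<\rho_1<1$, $\varphi_i=\log[\rho_i/(1-\rho_i)]$, and $\varepsilon\in(0,\varepsilon_0)$ with $\varepsilon_0=1/(\varphi_1-\varphi_0)$. For each $\rho\in M^o$ we have $D^\pm_{\mathrm G}S^o_\varepsilon(\rho)\subset\mathcal H^1_0$. Moreover, $S^o_\varepsilon$ is a Gâteaux viscosity solution of $\mathbb H(\rho,DU)=0$ in $M^o$, namely for any $\rho\in M^o$ $$\mathbb H(\rho,h)\le0\quad\forall h\in D^+_{\mathrm G}S^o_\varepsilon(\rho),\qquad \mathbb H(\rho,h)\ge0\quad\forall h\in D^-_{\mathrm G}S^o_\varepsilon(\rho).$$
   Context: $f(a)=\sigma(a)=a(1-a)$. $M=\{\rho\in L^\infty([0,1]):0\le\rho\le1\}$ and $M^o=\{\rho\in C^2([0,1]):0<\rho<1,\ \rho(0)=\rho_0,\ \rho(1)=\rho_1\}$. $\mathcal H^1_0$ is the standard Sobolev space on $[0,1]$ of functions with square integrable derivative vanishing at $0$ and $1$. $\langle\cdot,\cdot\rangle$ denotes integration over $[0,1]$ of the product. The Hamiltonian $\mathbb H:M^o\times\mathcal H^1_0\to\mathbb R$ is $$\mathbb H(\rho,h)=\varepsilon\langle h_x,\sigma(\rho)h_x\rangle-\langle\varepsilon\rho_x-f(\rho),h_x\rangle.$$ $\mathcal F$ is the set of functions $\varphi(x)=\varphi_0+\mu([0,x])$, $x\in[0,1]$, with $\mu=d\varphi$ a positive Borel measure on $[0,1]$ of total mass $\varphi_1-\varphi_0$. $s(a)=a\log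 a+(1-a)\log(1-a)$ for $a\in[0,1]$ (with $0\log0=0$), $+\infty$ otherwise. $$\mathcal G_\varepsilon(\rho,\varphi)=\int_0^1\big[s(\rho)+s(\varepsilon\varphi_x)+(1-\rho)\varphi-\log(1+e^\varphi)\big]dx,\qquad(\rho,\varphi)\in M\times\mathcal F,$$ with $\mathcal G_\varepsilon(\rho,\varphi)=+\infty$ unless $d\varphi$ is absolutely continuous with density $\varphi_x$ bounded by $\varepsilon^{-1}$. $S^o_\varepsilon(\rho)=\inf_{\varphi\in\mathcal F}\mathcal G_\varepsilon(\rho,\varphi)$ for $\rho\in M$, extended to $L^\infty([0,1])$ by $S^o_\varepsilon(\rho)=+\infty$ for $\rho\notin M$. With $X=L^\infty([0,1])$ in duality with $X^*=L^1([0,1])$: for $g:X\to(-\infty,+\infty]$ and $g(\rho)<\infty$, $D^+_{\mathrm G}g(\rho)$ (resp. $D^-_{\mathrm G}g(\rho)$) is the set of $\ell\in L^1([0,1])$ such that for every $v\in L^\infty([0,1])$, $\limsup_{\lambda\downarrow0}\lambda^{-1}[g(\rho+\lambda v)-g(\rho)-\lambda\langle\ell,v\rangle]\le0$ (resp. $\liminf_{\lambda\downarrow0}\lambda^{-1}[g(\rho+\lambda v)-g(\rho)-\lambda\langle\ell,v\rangle]\ge0$). *)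

theory Defs
  imports "HOL-Probability.Probability"
begin

text \<open>
  Elements of $L^p([0,1])$ are handled through Borel representatives
  \<^typ>\<open>real \<Rightarrow> real\<close>; only the values on $[0,1]$ matter, and every functional below is
  invariant under modification on a null set.
\<close>

abbreviation unit_lborel :: "real measure" where
  "unit_lborel \<equiv> restrict_space lborel {0..1}"

definition Linf :: "(real \<Rightarrow> real) set" where
  "Linf = {v \<in> borel_measurable unit_lborel. \<exists>C. AE x in unit_lborel. \<bar>v x\<bar> \<le> C}"

definition L1 :: "(real \<Rightarrow> real) set" where
  "L1 = {l. integrable unit_lborel l}"

definition L2 :: "(real \<Rightarrow> real) set" where
  "L2 = {g \<in> borel_measurable unit_lborel. integrable unit_lborel (\<lambda>x. (g x)\<^sup>2)}"

definition pairing :: "(real \<Rightarrow> real) \<Rightarrow> (real \<Rightarrow> real) \<Rightarrow> real" where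
  "pairing u v = (LINT x|unit_lborel. u x * v x)"


section \<open>The Sobolev space\<close>

text \<open>Test functions: continuously differentiable, with compact support in the open interval.\<close>

definition test_functions :: "(real \<Rightarrow> real) set" where
  "test_functions = {\<psi>. (\<forall>x. \<psi> field_differentiable at x) \<and> continuous_on UNIV (deriv \<psi>) \<and>
     (\<exists>a b. 0 < a \<and> b < 1 \<and> (\<forall>x. x \<notin> {a..b} \<longrightarrow> \<psi> x = 0))}"

definition is_weak_deriv :: "(real \<Rightarrow> real) \<Rightarrow> (real \<Rightarrow> real) \<Rightarrow> bool" where
  "is_weak_deriv h g \<longleftrightarrow> (\<forall>\<psi>\<in>test_functions. pairing h (deriv \<psi>) = - pairing g \<psi>)"

text \<open>The boundary values are those of the continuous representative \<open>u\<close>.\<close>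

definition H10 :: "(real \<Rightarrow> real) set" where
  "H10 = {h \<in> L2. (\<exists>g\<in>L2. is_weak_deriv h g) \<and>
     (\<exists>u. continuous_on {0..1} u \<and> u 0 = 0 \<and> u 1 = 0 \<and> (AE x in unit_lborel. h x = u x))}"

text \<open>Determined up to a null set for \<open>h \<in> H10\<close>.\<close>

definition weak_deriv :: "(real \<Rightarrow> real) \<Rightarrow> real \<Rightarrow> real" where
  "weak_deriv h = (SOME g. g \<in> L2 \<and> is_weak_deriv h g)"


section \<open>Profiles and the Hamiltonian\<close>

definition flux :: "real \<Rightarrow> real" where
  "flux a = a * (1 - a)"

definition mobility :: "real \<Rightarrow> real" where
  "mobility a = a * (1 - a)"

definition C2_unit :: "(real \<Rightarrow> real) set" where
  "C2_unit = {\<rho>. \<exists>\<rho>' \<rho>''. (\<forall>x\<in>{0..1}. (\<rho> has_real_derivative \<rho>' x) (at x within {0..1}) \<and>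
       (\<rho>' has_real_derivative \<rho>'' x) (at x within {0..1})) \<and> continuous_on {0..1} \<rho>''}"

definition profiles :: "(real \<Rightarrow> real) set" where
  "profiles = {\<rho> \<in> Linf. AE x in unit_lborel. 0 \<le> \<rho> x \<and> \<rho> x \<le> 1}"

definition smooth_profiles :: "real \<Rightarrow> real \<Rightarrow> (real \<Rightarrow> real) set" where
  "smooth_profiles \<rho>0 \<rho>1 =
     {\<rho> \<in> C2_unit. (\<forall>x\<in>{0..1}. 0 < \<rho> x \<and> \<rho> x < 1) \<and> \<rho> 0 = \<rho>0 \<and> \<rho> 1 = \<rho>1}"

definition Hamiltonian :: "real \<Rightarrow> (real \<Rightarrow> real) \<Rightarrow> (real \<Rightarrow> real) \<Rightarrow> real" where
  "Hamiltonian \<epsilon> \<rho> h =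
     \<epsilon> * pairing (weak_deriv h) (\<lambda>x. mobility (\<rho> x) * weak_deriv h x)
     - pairing (\<lambda>x. \<epsilon> * vector_derivative \<rho> (at x within {0..1}) - flux (\<rho> x)) (weak_deriv h)"


section \<open>The quasi-potential\<close>

text \<open>\<open>\<mu>\<close> may have an atom at 0, so it is determined by \<open>\<phi>\<close> only once \<open>\<phi>0\<close> is given.\<close>

definition has_dphi :: "real \<Rightarrow> (real \<Rightarrow> real) \<Rightarrow> real measure \<Rightarrow> bool" where
  "has_dphi \<phi>0 \<phi> \<mu> \<longleftrightarrow> sets \<mu> = sets (restrict_space borel {0..1}) \<and> finite_measure \<mu> \<and>
     (\<forall>x\<in>{0..1}. \<phi> x = \<phi>0 + measure \<mu> {0..x})"

definition dphi :: "real \<Rightarrow> (real \<Rightarrow> real) \<Rightarrow> real measure" where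
  "dphi \<phi>0 \<phi> = (THE \<mu>. has_dphi \<phi>0 \<phi> \<mu>)"

definition phi_space :: "real \<Rightarrow> real \<Rightarrow> (real \<Rightarrow> real) set" where
  "phi_space \<phi>0 \<phi>1 = {\<phi>. \<exists>\<mu>. has_dphi \<phi>0 \<phi> \<mu> \<and> measure \<mu> {0..1} = \<phi>1 - \<phi>0}"

definition phi_x :: "real \<Rightarrow> (real \<Rightarrow> real) \<Rightarrow> real \<Rightarrow> real" where
  "phi_x \<phi>0 \<phi> x = enn2real (RN_deriv unit_lborel (dphi \<phi>0 \<phi>) x)"

text \<open>
  The convention $0\log 0=0$ is built in since \<^prop>\<open>ln (0::real) = 0\<close>. The value $+\infty$
  of $s$ outside $[0,1]$ is never met in \<open>trial_G\<close>, where $\rho$ takes values in $[0,1]$ and the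
  case distinction confines $\varepsilon\varphi_x$ to $[0,1]$ almost everywhere.
\<close>

definition entropy_s :: "real \<Rightarrow> real" where
  "entropy_s a = a * ln a + (1 - a) * ln (1 - a)"

definition trial_G :: "real \<Rightarrow> real \<Rightarrow> (real \<Rightarrow> real) \<Rightarrow> (real \<Rightarrow> real) \<Rightarrow> ereal" where
  "trial_G \<epsilon> \<phi>0 \<rho> \<phi> =
     (if absolutely_continuous unit_lborel (dphi \<phi>0 \<phi>) \<and>
         (AE x in unit_lborel. phi_x \<phi>0 \<phi> x \<le> 1 / \<epsilon>)
      then ereal (LINT x|unit_lborel. entropy_s (\<rho> x) + entropy_s (\<epsilon> * phi_x \<phi>0 \<phi> x)
             + (1 - \<rho> x) * \<phi> x - ln (1 + exp (\<phi> x)))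
      else \<infinity>)"

definition quasi_potential ::
    "real \<Rightarrow> real \<Rightarrow> real \<Rightarrow> (real \<Rightarrow> real) \<Rightarrow> ereal" where
  "quasi_potential \<epsilon> \<phi>0 \<phi>1 \<rho> =
     (if \<rho> \<in> profiles then INF \<phi>\<in>phi_space \<phi>0 \<phi>1. trial_G \<epsilon> \<phi>0 \<rho> \<phi> else \<infinity>)"


section \<open>Gateaux semidifferentials and viscosity solutions\<close>

text \<open>Meant for functionals \<open>g > -\<infinity>\<close> at points where \<open>g \<rho> < \<infinity>\<close>.\<close>

definition gateaux_quotient ::
    "((real \<Rightarrow> real) \<Rightarrow> ereal) \<Rightarrow> (real \<Rightarrow> real) \<Rightarrow> (real \<Rightarrow> real) \<Rightarrow> (real \<Rightarrow> real) \<Rightarrow> real \<Rightarrow> ereal" where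
  "gateaux_quotient g \<rho> l v t =
     ereal (inverse t) * (g (\<lambda>x. \<rho> x + t * v x) - g \<rho> - ereal (t * pairing l v))"

definition gateaux_superdiff :: "((real \<Rightarrow> real) \<Rightarrow> ereal) \<Rightarrow> (real \<Rightarrow> real) \<Rightarrow> (real \<Rightarrow> real) set" where
  "gateaux_superdiff g \<rho> =
     {l \<in> L1. \<forall>v\<in>Linf. Limsup (at_right 0) (gateaux_quotient g \<rho> l v) \<le> 0}"

definition gateaux_subdiff :: "((real \<Rightarrow> real) \<Rightarrow> ereal) \<Rightarrow> (real \<Rightarrow> real) \<Rightarrow> (real \<Rightarrow> real) set" where
  "gateaux_subdiff g \<rho> =
     {l \<in> L1. \<forall>v\<in>Linf. Liminf (at_right 0) (gateaux_quotient g \<rho> l v) \<ge> 0}"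

definition gateaux_viscosity_solution ::
    "((real \<Rightarrow> real) \<Rightarrow> (real \<Rightarrow> real) \<Rightarrow> real) \<Rightarrow> (real \<Rightarrow> real) set \<Rightarrow> ((real \<Rightarrow> real) \<Rightarrow> ereal) \<Rightarrow> bool" where
  "gateaux_viscosity_solution H A U \<longleftrightarrow>
     (\<forall>\<rho>\<in>A. (\<forall>h\<in>gateaux_superdiff U \<rho>. H \<rho> h \<le> 0) \<and> (\<forall>h\<in>gateaux_subdiff U \<rho>. H \<rho> h \<ge> 0))"

end

(*
  The profile rho enters the trial functional G(rho, phi) only through the integral of s(rho) and
  through the linear term -<rho, phi>. Hence S = inf_phi G(., phi) is the integral of s(rho) plus a
  concave function, and its directional derivatives are governed by the minimizers phi at rho
  (Danskin): an element of the subdifferential equals s'(rho) - phi for every minimizer phi, and an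
  element of the superdifferential is s'(rho) - psi with psi in the closed convex hull of the
  minimizers.

  Replacing -log(1 + e^phi) by its tangent line at a given phi makes the minimization problem
  convex, with an explicit solution of the form eps phi_x = logistic(u), u Lipschitz. So the infimum
  may be restricted to a convex and compact class of densities phi_x, the minimum is attained, and,
  by the equality case, minimizers solve the Euler-Lagrange equation.

  For h = s'(rho) - psi the Hamiltonian H(rho, h) is the integral Q of
  (rho_x - sigma(rho) psi_x)(1 - eps psi_x). If psi solves the Euler-Lagrange equation the integrand
  is the derivative of (rho + q)(1 - eps psi_x) + eps psi_x, q = 1/(1 + e^psi), which equals 1 at
  both end points; so Q = 0 at minimizers. Convexity of Q in psi_x gives Q <= 0 on the convex hull.
*)

theory Submission
  imports Defs "HOL-Complex_Analysis.Great_Picard" "HOL-Real_Asymp.Real_Asymp"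
begin

section \<open>Integration on the unit interval\<close>

text \<open>The obstacle is the concave term -log(1 + e^phi): \<open>G\<close> is not convex in phi,
  minimizers need not be unique and S need not be differentiable. Weak topologies are avoided: one
  minimization of the convexified problem sends every admissible density into
  \<open>lip_densities\<close>, a class that is both convex (for the separation argument) and
  compact for uniform convergence (for existence and for limits of minimizers). Its Lipschitz
  constant 1/eps^2 is a factor 1/eps from the drift times a factor 1/eps from phi_x =
  logistic(u)/eps. The bound eps < eps_0 puts the mean of eps phi_x into (0,1), so that a logistic
  profile with that mean exists. The closed convex hull of the minimizers is never formed.
  Separation only gives an element of the superdifferential the form s'(rho) - psi with psi_x in
  \<open>lip_densities\<close>; Q <= 0 then follows by comparison with a single minimizer for each
  tolerance, selected by the superdifferential condition in a direction adapted to psi.\<close>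

lemma space_unit_lborel [simp]: "space unit_lborel = {0..1}"
  by (simp add: space_restrict_space)

lemma prob_space_unit_lborel: "prob_space unit_lborel"
  by (rule prob_spaceI) (simp add: emeasure_restrict_space)

interpretation unit_lborel: prob_space unit_lborel
  by (rule prob_space_unit_lborel)

lemma LINT_unit_lborel_const [simp]: "(LINT x|unit_lborel. c) = (c::real)"
  using unit_lborel.prob_space by simp

lemma AE_unit_lborelI: "(\<And>x. x \<in> {0..1} \<Longrightarrow> Q x) \<Longrightarrow> AE x in unit_lborel. Q x"
  by (rule AE_I2) simp

lemma LINT_unit_lborel: "(LINT x|unit_lborel. (f x::real)) = (LINT x|lborel. indicator {0..1} x * f x)"
  by (subst integral_restrict_space) simp_all

lemma AE_unit_lborel: "(AE x in unit_lborel. Q x) \<longleftrightarrow> (AE x in lborel. x \<in> {0..1} \<longrightarrow> Q x)"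
  by (subst AE_restrict_space_iff) simp_all

lemma continuous_unit_measurable:
  "continuous_on {0..1} f \<Longrightarrow> f \<in> borel_measurable unit_lborel" for f :: "real \<Rightarrow> real"
  using borel_measurable_continuous_on_restrict[of "{0..1}" f]
    measurable_cong_sets[OF sets_restrict_space_cong[OF sets_lborel] refl] by blast

lemma bounded_unit_integrable:
  fixes f :: "real \<Rightarrow> real"
  assumes "f \<in> borel_measurable unit_lborel" "AE x in unit_lborel. \<bar>f x\<bar> \<le> B"
  shows "integrable unit_lborel f"
  using assms by (intro unit_lborel.integrable_const_bound[of f B]) auto

lemma continuous_unit_integrable:
  fixes f :: "real \<Rightarrow> real"
  assumes "continuous_on {0..1} f"
  shows "integrable unit_lborel f"
proof -
  have "compact (f ` {0..1})"
    using assms by (intro compact_continuous_image) auto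
  then obtain B where "\<And>x. x \<in> {0..1} \<Longrightarrow> \<bar>f x\<bar> \<le> B"
    using compact_imp_bounded bounded_iff by (metis imageI real_norm_def)
  then show ?thesis
    by (intro bounded_unit_integrable[of f B] continuous_unit_measurable assms AE_unit_lborelI) auto
qed

lemma LINT_unit_FTC:
  assumes "\<And>x. x \<in> {0..1} \<Longrightarrow> (F has_real_derivative f x) (at x within {0..1})"
    and "continuous_on {0..1} f"
  shows "(LINT x|unit_lborel. f x) = F 1 - F 0"
  unfolding LINT_unit_lborel
  using integral_FTC_Icc[of 0 1 F f] assms
  by (simp add: has_real_derivative_iff_has_vector_derivative)

lemma LINT_unit_abs_le:
  fixes f :: "real \<Rightarrow> real"
  assumes "AE x in unit_lborel. \<bar>f x\<bar> \<le> B" "0 \<le> B"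
  shows "\<bar>LINT x|unit_lborel. f x\<bar> \<le> B"
proof (cases "integrable unit_lborel f")
  case True
  have "\<bar>LINT x|unit_lborel. f x\<bar> \<le> (LINT x|unit_lborel. \<bar>f x\<bar>)"
    using integral_norm_bound[of unit_lborel f] by simp
  also have "\<dots> \<le> (LINT x|unit_lborel. B)"
    using assms True by (intro integral_mono_AE) auto
  finally show ?thesis by (simp only: LINT_unit_lborel_const)
\<comment> \<open>The integral of a nonintegrable function is 0 by convention.\<close>
qed (simp add: assms not_integrable_integral_eq)

text \<open>Continuity upgrades almost everywhere to everywhere, end points included, which the
  pointwise Euler-Lagrange equation requires.\<close>

lemma continuous_eq_0_of_LINT_unit:
  fixes f :: "real \<Rightarrow> real"
  assumes "continuous_on {0..1} f" "\<And>x. x \<in> {0..1} \<Longrightarrow> 0 \<le> f x"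
    and "(LINT x|unit_lborel. f x) \<le> 0" "x \<in> {0..1}"
  shows "f x = 0"
proof -
  have si: "set_integrable lborel {0..1} f"
    using assms(1) by (rule borel_integrable_atLeastAtMost')
  have "integral {0..1} f = (LINT x|unit_lborel. f x)"
    using set_borel_integral_eq_integral(2)[OF si] 
    unfolding LINT_unit_lborel set_lebesgue_integral_def by simp
  then have "integral (cbox 0 1) f = 0"
    using assms integral_nonneg[OF integrable_continuous_interval[OF assms(1)]] by force
  then have "(f has_integral 0) (cbox 0 1)"
    using integrable_continuous_interval[OF assms(1)] by (metis cbox_interval integrable_integral)
  then show ?thesis
    using has_integral_0_cbox_imp_0[of 0 1 f x] assms by auto
qed

text \<open>The variable \<open>x\<close> sits in an indicator and the measure stays fixed, so
  linearity, dominated convergence and Fubini apply directly. Outside the unit interval the function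
  is extended by its end values.\<close>

definition primitive :: "real \<Rightarrow> (real \<Rightarrow> real) \<Rightarrow> real \<Rightarrow> real" where
  "primitive c p x = c + (LINT y|unit_lborel. indicator {..x} y * p y)"

lemma integrable_indicator_mult:
  fixes p :: "real \<Rightarrow> real"
  assumes "integrable unit_lborel p" "A \<in> sets borel"
  shows "integrable unit_lborel (\<lambda>y. indicator A y * p y)"
proof (rule Bochner_Integration.integrable_bound[OF assms(1)])
  have "indicator A \<in> borel_measurable unit_lborel"
    using assms(2) by (intro measurable_restrict_space1) auto
  then show "(\<lambda>y. indicator A y * p y) \<in> borel_measurable unit_lborel"
    using assms(1) by measurable
qed (auto simp: indicator_def)

lemma primitive_0: "primitive c p 0 = c"
proof -
  have "AE y in unit_lborel. indicator {..0} y * p y = 0"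
    unfolding AE_unit_lborel using AE_lborel_singleton[of "0::real"]
    by eventually_elim (auto simp: indicator_def)
  then show ?thesis
    unfolding primitive_def by (simp add: integral_eq_zero_AE)
qed

lemma primitive_1: "primitive c p 1 = c + (LINT x|unit_lborel. p x)"
  unfolding primitive_def
  by (auto intro!: Bochner_Integration.integral_cong)

lemma primitive_diff:
  assumes "integrable unit_lborel p" "integrable unit_lborel q"
  shows "primitive a p x - primitive b q x = primitive (a - b) (\<lambda>y. p y - q y) x"
  unfolding primitive_def
  using assms by (simp add: right_diff_distrib integrable_indicator_mult Bochner_Integration.integral_diff)

lemma primitive_abs_diff_le:
  assumes "p \<in> borel_measurable unit_lborel" "AE y in unit_lborel. \<bar>p y\<bar> \<le> B"
    and "x \<in> {0..1}" "z \<in> {0..1}"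
  shows "\<bar>primitive c p x - primitive c p z\<bar> \<le> B * \<bar>x - z\<bar>"
proof -
  have *: "\<bar>primitive c p z - primitive c p x\<bar> \<le> B * (z - x)" if "x \<le> z" "x \<in> {0..1}" "z \<in> {0..1}" for x z
  proof -
    have p: "integrable unit_lborel p"
      by (rule bounded_unit_integrable) fact+
    have "primitive c p z - primitive c p x =
        (LINT y|unit_lborel. indicator {..z} y * p y - indicator {..x} y * p y)"
      unfolding primitive_def
      by (subst Bochner_Integration.integral_diff) (simp_all add: integrable_indicator_mult[OF p])
    also have "\<dots> = (LINT y|unit_lborel. indicator {x<..z} y * p y)"
      using that by (intro Bochner_Integration.integral_cong) (auto simp: indicator_def)
    also have "\<bar>\<dots>\<bar> \<le> (LINT y|unit_lborel. \<bar>indicator {x<..z} y * p y\<bar>)"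
      using integral_norm_bound[of unit_lborel "\<lambda>y. indicator {x<..z} y * p y"] by simp
    also have "\<dots> \<le> (LINT y|unit_lborel. indicator {x<..z} y * B)"
      using assms(2)
      by (intro integral_mono_AE integrable_abs integrable_indicator_mult p)
        (auto simp: abs_mult indicator_def elim!: eventually_mono)
    also have "\<dots> = (LINT y|lborel. indicator {x<..z} y * B)"
      unfolding LINT_unit_lborel using that
      by (intro Bochner_Integration.integral_cong) (auto simp: indicator_def)
    also have "\<dots> = B * (z - x)"
      using that by (simp add: mult.commute)
    finally show ?thesis .
  qed
  show ?thesis
    using *[of x z] *[of z x] assms by (cases "x \<le> z") (auto simp: abs_minus_commute)
qed

lemma continuous_on_primitive:
  assumes "p \<in> borel_measurable unit_lborel" "AE y in unit_lborel. \<bar>p y\<bar> \<le> B"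
  shows "continuous_on {0..1} (primitive c p)"
proof -
  have "AE y in unit_lborel. \<bar>p y\<bar> \<le> max B 0"
    using assms(2) by eventually_elim auto
  then have "(max B 0)-lipschitz_on {0..1} (primitive c p)"
    by (intro lipschitz_onI) (auto simp: dist_real_def intro!: primitive_abs_diff_le[OF assms(1)])
  then show ?thesis
    by (rule lipschitz_on_continuous_on)
qed

lemma primitive_has_derivative:
  assumes "continuous_on {0..1} p" "x \<in> {0..1}"
  shows "(primitive c p has_real_derivative p x) (at x within {0..1})"
proof -
  have *: "primitive c p z = c + integral {0..z} p" if "z \<in> {0..1}" for z
  proof -
    have cz: "continuous_on {0..z} p"
      using assms(1) by (rule continuous_on_subset) (use that in auto)
    have si: "set_integrable lborel {0..z} p"
      using cz by (rule borel_integrable_atLeastAtMost')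
    have "(LINT y|unit_lborel. indicator {..z} y * p y) = (LINT y|lborel. indicator {0..z} y *\<^sub>R p y)"
      unfolding LINT_unit_lborel using that
      by (intro Bochner_Integration.integral_cong) (auto simp: indicator_def)
    also have "\<dots> = integral {0..z} p"
      using set_borel_integral_eq_integral(2)[OF si] unfolding set_lebesgue_integral_def .
    finally show ?thesis unfolding primitive_def by simp
  qed
  have "((\<lambda>z. c + integral {0..z} p) has_real_derivative p x) (at x within {0..1})"
    using integral_has_real_derivative[OF assms] by (auto intro!: derivative_eq_intros)
  then show ?thesis
    by (rule has_field_derivative_transform_within[OF _ zero_less_one assms(2)]) (use * in auto)
qed

lemma primitive_dist_le:
  assumes p: "integrable unit_lborel p" and q: "integrable unit_lborel q"
    and B: "\<And>y. y \<in> {0..1} \<Longrightarrow> \<bar>p y - q y\<bar> \<le> B"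
  shows "\<bar>primitive c p x - primitive c q x\<bar> \<le> B"
proof -
  have "0 \<le> B" using B[of 0] by simp
  then have "\<bar>LINT y|unit_lborel. indicator {..x} y * (p y - q y)\<bar> \<le> B"
    using B by (intro LINT_unit_abs_le AE_unit_lborelI) (auto simp: indicator_def)
  then show ?thesis
    unfolding primitive_diff[OF p q] by (simp add: primitive_def del: Bochner_Integration.integral_diff)
qed

lemma bounded_mult_integrable:
  assumes [measurable]: "f \<in> borel_measurable unit_lborel" and "AE x in unit_lborel. \<bar>f x\<bar> \<le> B"
    and c: "integrable unit_lborel (c :: real \<Rightarrow> real)"
  shows "integrable unit_lborel (\<lambda>x. f x * c x)"
proof (rule Bochner_Integration.integrable_bound)
  show "integrable unit_lborel (\<lambda>x. B * c x)"
    using c by simp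
  have [measurable]: "c \<in> borel_measurable unit_lborel"
    using c by auto
  show "(\<lambda>x. f x * c x) \<in> borel_measurable unit_lborel"
    by measurable
  show "AE x in unit_lborel. norm (f x * c x) \<le> norm (B * c x)"
    using assms(2) by eventually_elim (auto simp: abs_mult intro!: mult_right_mono)
qed

lemma Linf_integrable: "v \<in> Linf \<Longrightarrow> integrable unit_lborel v"
  unfolding Linf_def by (auto intro: bounded_unit_integrable)

lemma Linf_mult_integrable:
  assumes "v \<in> Linf" "integrable unit_lborel f"
  shows "integrable unit_lborel (\<lambda>x. v x * f x)"
  using assms unfolding Linf_def by (auto intro: bounded_mult_integrable)

lemma continuous_in_Linf:
  assumes "continuous_on {0..1} v"
  shows "v \<in> Linf"
proof -
  have "compact (v ` {0..1})"
    using assms by (intro compact_continuous_image) auto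
  then obtain B where "\<And>x. x \<in> {0..1} \<Longrightarrow> \<bar>v x\<bar> \<le> B"
    using compact_imp_bounded bounded_iff by (metis imageI real_norm_def)
  then show ?thesis
    unfolding Linf_def using continuous_unit_measurable[OF assms] by (auto intro!: exI[of _ B] AE_unit_lborelI)
qed

lemma pairing_add_scale:
  assumes "integrable unit_lborel (\<lambda>x. f x * g x)" "integrable unit_lborel (\<lambda>x. v x * g x)"
  shows "pairing (\<lambda>x. f x + t * v x) g = pairing f g + t * pairing v g"
proof -
  have "pairing (\<lambda>x. f x + t * v x) g = (LINT x|unit_lborel. f x * g x + t * (v x * g x))"
    unfolding pairing_def by (simp add: algebra_simps)
  then show ?thesis
    using assms by (simp add: pairing_def)
qed

text \<open>Integration by parts for merely integrable functions: up to a null set, both sides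
  integrate \<open>f x * g y\<close> over the triangle \<open>x \<le> y\<close>.\<close>

lemma LINT_mult_primitive:
  assumes [measurable]: "f \<in> borel_measurable unit_lborel" "g \<in> borel_measurable unit_lborel"
    and f: "integrable unit_lborel f" and g: "integrable unit_lborel g"
  shows "(LINT y|unit_lborel. g y * primitive 0 f y) =
    (LINT x|unit_lborel. f x * ((LINT y|unit_lborel. g y) - primitive 0 g x))"
proof -
  interpret pair_sigma_finite unit_lborel unit_lborel ..
  let ?k = "\<lambda>x y. indicator {..y} x * f x * g y"
  have le: "(\<lambda>(x, y). x \<le> y) \<in> measurable (unit_lborel \<Otimes>\<^sub>M unit_lborel) (count_space UNIV)"
  proof -
    have [measurable]: "(\<lambda>x. x) \<in> borel_measurable unit_lborel"
      by (intro measurable_restrict_space1) auto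
    show ?thesis
      by measurable
  qed
  have "integrable (unit_lborel \<Otimes>\<^sub>M unit_lborel) (\<lambda>(x, y). f x * g y)"
    using f g by (intro Fubini_integrable) (auto simp: abs_mult)
  then have "integrable (unit_lborel \<Otimes>\<^sub>M unit_lborel) (\<lambda>(x, y). ?k x y)"
  proof (rule Bochner_Integration.integrable_bound)
    have [measurable]: "(\<lambda>(x, y). indicator {..y} x :: real) \<in> borel_measurable (unit_lborel \<Otimes>\<^sub>M unit_lborel)"
      using le by (simp add: indicator_def case_prod_beta of_bool_def del: indicator_simps)
    show "(\<lambda>(x, y). ?k x y) \<in> borel_measurable (unit_lborel \<Otimes>\<^sub>M unit_lborel)"
      by measurable
  qed (auto simp: indicator_def)
  then have "(LINT y|unit_lborel. LINT x|unit_lborel. ?k x y) = (LINT x|unit_lborel. LINT y|unit_lborel. ?k x y)"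
    by (rule Fubini_integral)
  moreover have "(LINT x|unit_lborel. ?k x y) = g y * primitive 0 f y" for y
    by (simp add: primitive_def mult.commute)
  moreover have "(LINT y|unit_lborel. ?k x y) = f x * ((LINT y|unit_lborel. g y) - primitive 0 g x)" for x
  proof -
    have [measurable]: "indicator {..x} \<in> borel_measurable unit_lborel"
         "indicator {x..} \<in> borel_measurable unit_lborel"
      by (intro measurable_restrict_space1; simp)+
    have "(LINT y|unit_lborel. ?k x y) = f x * (LINT y|unit_lborel. indicator {x..} y * g y)"
      by (subst integral_mult_right_zero[symmetric], intro Bochner_Integration.integral_cong)
        (auto simp: indicator_def)
    also have "(LINT y|unit_lborel. indicator {x..} y * g y) =
        (LINT y|unit_lborel. g y - indicator {..x} y * g y)"
    proof (rule integral_cong_AE)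
      show "AE y in unit_lborel. indicator {x..} y * g y = g y - indicator {..x} y * g y"
        unfolding AE_unit_lborel using AE_lborel_singleton[of x]
        by eventually_elim (auto simp: indicator_def)
    qed measurable
    also have "\<dots> = (LINT y|unit_lborel. g y) - primitive 0 g x"
      unfolding primitive_def
      by (simp add: Bochner_Integration.integral_diff g integrable_indicator_mult)
    finally show ?thesis .
  qed
  ultimately show ?thesis by (simp only:)
qed

text \<open>Pushed forward to the line along the inclusion, both become finite Borel measures with
  the same distribution function. A possible atom at 0 is seen by \<open>{0..0}\<close>.\<close>

lemma unit_measure_eqI:
  assumes sets: "sets \<mu> = sets (restrict_space borel {0..1::real})" "sets \<nu> = sets (restrict_space borel {0..1::real})"
    and fin: "finite_measure \<mu>" "finite_measure \<nu>"
    and eq: "\<And>x. x \<in> {0..1} \<Longrightarrow> measure \<mu> {0..x} = measure \<nu> {0..x}"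
  shows "\<mu> = \<nu>"
proof -
  have meas: "(\<lambda>x. x) \<in> measurable M borel" if "sets M = sets (restrict_space borel {0..1::real})" for M
    by (subst measurable_cong_sets[OF that refl]) (intro measurable_restrict_space1, simp)
  have sp: "space M = {0..1}" if "sets M = sets (restrict_space borel {0..1::real})" for M
    using sets_eq_imp_space_eq[OF that] by (simp add: space_restrict_space)
  have fb: "finite_borel_measure (distr M borel (\<lambda>x. x))"
    if "sets M = sets (restrict_space borel {0..1::real})" "finite_measure M" for M
    using finite_measure.finite_measure_distr[OF that(2) meas[OF that(1)]]
    by (auto simp: finite_borel_measure_def finite_borel_measure_axioms_def)
  have cdf: "cdf (distr M borel (\<lambda>x. x)) x = (if x < 0 then 0 else measure M {0..min x 1})"
    if "sets M = sets (restrict_space borel {0..1::real})" for M x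
  proof -
    have "{..x} \<inter> {0..1} = (if x < 0 then {} else {0..min x 1})" by auto
    then show ?thesis
      unfolding cdf_def by (subst measure_distr) (use meas[OF that] in \<open>auto simp: sp[OF that]\<close>)
  qed
  have "distr \<mu> borel (\<lambda>x. x) = distr \<nu> borel (\<lambda>x. x)"
    by (rule cdf_unique') (use eq in \<open>auto simp: fb sets fin cdf\<close>)
  moreover have "emeasure M A = emeasure (distr M borel (\<lambda>x. x)) A"
    if "sets M = sets (restrict_space borel {0..1::real})" "A \<in> sets M" for M A
  proof -
    have "A \<in> sets borel"
      using that by (auto simp: sets_restrict_space)
    moreover have "A \<subseteq> space M"
      using that(2) by (rule sets.sets_into_space)
    ultimately show ?thesis
      by (subst emeasure_distr) (use meas[OF that(1)] in \<open>auto simp: Int_absorb2\<close>)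
  qed
  ultimately show ?thesis
    using sets by (intro measure_eqI) auto
qed

lemma density_measure_atMost:
  assumes f: "integrable unit_lborel f" and "AE y in unit_lborel. 0 \<le> f y" and "x \<in> {0..1}"
  shows "finite_measure (density unit_lborel (\<lambda>y. ennreal (f y)))"
    and "measure (density unit_lborel (\<lambda>y. ennreal (f y))) {0..x} = primitive 0 f x"
proof -
  have [measurable]: "f \<in> borel_measurable unit_lborel"
    using f by auto
  have *: "emeasure (density unit_lborel (\<lambda>y. ennreal (f y))) {0..z} = ennreal (primitive 0 f z)"
    "0 \<le> primitive 0 f z" if "z \<in> {0..1}" for z
  proof -
    have zs: "{0..z} \<in> sets unit_lborel"
      using that by (auto simp: sets_restrict_space intro!: image_eqI[of _ _ "{0..z}"])
    have "emeasure (density unit_lborel (\<lambda>y. ennreal (f y))) {0..z}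
        = (\<integral>\<^sup>+ y. ennreal (f y) * indicator {0..z} y \<partial>unit_lborel)"
      using zs by (subst emeasure_density) auto
    also have "\<dots> = (\<integral>\<^sup>+ y. ennreal (indicator {..z} y * f y) \<partial>unit_lborel)"
      by (intro nn_integral_cong) (auto simp: indicator_def)
    also have "\<dots> = ennreal (LINT y|unit_lborel. indicator {..z} y * f y)"
      using assms by (intro nn_integral_eq_integral integrable_indicator_mult) (auto simp: indicator_def elim!: eventually_mono)
    finally show "emeasure (density unit_lborel (\<lambda>y. ennreal (f y))) {0..z} = ennreal (primitive 0 f z)"
      by (simp add: primitive_def)
    show "0 \<le> primitive 0 f z"
      unfolding primitive_def using assms by (auto intro!: integral_nonneg_AE simp: indicator_def elim!: eventually_mono)
  qed
  show "finite_measure (density unit_lborel (\<lambda>y. ennreal (f y)))"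
    using *(1)[of 1] by (intro finite_measureI) auto
  show "measure (density unit_lborel (\<lambda>y. ennreal (f y))) {0..x} = primitive 0 f x"
    using *[OF assms(3)] by (simp add: measure_def)
qed

text \<open>The positive and the negative part of \<open>g\<close> are densities of measures with
  equal distribution functions, hence of the same measure.\<close>

lemma AE_0_of_primitive:
  assumes g: "integrable unit_lborel g"
    and 0: "\<And>x. x \<in> {0..1} \<Longrightarrow> primitive 0 g x = 0"
  shows "AE x in unit_lborel. g x = 0"
proof -
  have [measurable]: "g \<in> borel_measurable unit_lborel"
    using g by auto
  let ?p = "\<lambda>x. max (g x) 0" and ?n = "\<lambda>x. max (- g x) 0"
  have pn: "integrable unit_lborel ?p" "integrable unit_lborel ?n"
    using g by (auto intro!: integrable_max)
  have eq: "primitive 0 ?p x = primitive 0 ?n x" if "x \<in> {0..1}" for x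
  proof -
    have "primitive 0 ?p x - primitive 0 ?n x = primitive 0 g x"
      by (subst primitive_diff[OF pn]) (auto simp: max_def intro!: arg_cong2[of _ _ _ _ primitive, THEN fun_cong])
    then show ?thesis using 0[OF that] by simp
  qed
  have sets: "sets unit_lborel = sets (restrict_space borel {0..1})"
    by (rule sets_restrict_space_cong) simp
  have "density unit_lborel (\<lambda>x. ennreal (?p x)) = density unit_lborel (\<lambda>x. ennreal (?n x))"
  proof (rule unit_measure_eqI)
    fix x :: real assume x: "x \<in> {0..1}"
    show "measure (density unit_lborel (\<lambda>x. ennreal (?p x))) {0..x} =
        measure (density unit_lborel (\<lambda>x. ennreal (?n x))) {0..x}"
      using density_measure_atMost(2)[OF pn(1) AE_I2 x] density_measure_atMost(2)[OF pn(2) AE_I2 x] eq[OF x]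
      by (simp only: max.cobounded2)
  next
    show "finite_measure (density unit_lborel (\<lambda>x. ennreal (?p x)))"
      by (rule density_measure_atMost(1)[OF pn(1), of 0]) auto
    show "finite_measure (density unit_lborel (\<lambda>x. ennreal (?n x)))"
      by (rule density_measure_atMost(1)[OF pn(2), of 0]) auto
  qed (simp_all add: sets)
  then have "AE x in unit_lborel. ennreal (?p x) = ennreal (?n x)"
    by (intro unit_lborel.density_unique) auto
  then show ?thesis
    by eventually_elim (auto simp: max_def split: if_splits)
qed

section \<open>Weak derivatives\<close>

lemma has_real_derivative_max_0_square:
  "((\<lambda>t. (max 0 t)\<^sup>2) has_real_derivative 2 * max 0 t) (at t)" for t :: real
proof (cases t "0::real" rule: linorder_cases)
  case less
  have "((\<lambda>t::real. 0) has_real_derivative 0) (at t)" by simp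
  then have "((\<lambda>t. (max 0 t)\<^sup>2) has_real_derivative 0) (at t)"
    by (rule DERIV_cong_ev[THEN iffD1, rotated -1])
      (use less in \<open>auto intro: eventually_mono[OF eventually_nhds_in_open[of "{..<0}"]]\<close>)
  then show ?thesis using less by simp
next
  case greater
  have "((\<lambda>t::real. t\<^sup>2) has_real_derivative 2 * t) (at t)"
    by (auto intro!: derivative_eq_intros)
  then have "((\<lambda>t. (max 0 t)\<^sup>2) has_real_derivative 2 * t) (at t)"
    by (rule DERIV_cong_ev[THEN iffD1, rotated -1])
      (use greater in \<open>auto intro: eventually_mono[OF eventually_nhds_in_open[of "{0<..}"]]\<close>)
  then show ?thesis using greater by simp
next
  case equal
  have "((\<lambda>h::real. (max 0 h)\<^sup>2 / h) \<longlongrightarrow> 0) (at 0)"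
  proof (rule tendsto_rabs_zero_cancel, rule tendsto_sandwich[of "\<lambda>_. 0" _ _ "\<lambda>h. \<bar>h\<bar>"])
    show "\<forall>\<^sub>F h in at 0. \<bar>(max 0 h)\<^sup>2 / h\<bar> \<le> \<bar>h::real\<bar>"
      by (intro always_eventually) (auto simp: power2_eq_square max_def)
    show "((\<lambda>h::real. \<bar>h\<bar>) \<longlongrightarrow> 0) (at 0)"
      by (rule tendsto_rabs_zero) simp
    show "((\<lambda>h::real. 0) \<longlongrightarrow> 0) (at 0)"
      by simp
  qed simp
  then show ?thesis using equal by (simp add: DERIV_def)
qed

text \<open>With y the squared positive part of (x - a)(b - x), which lies in [0,1] and is positive
  exactly on (a,b), the functions 1 - (1 - y)^n increase to the indicator of (a,b). The square makes
  the positive part continuously differentiable.\<close>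

definition bump :: "real \<Rightarrow> real \<Rightarrow> nat \<Rightarrow> real \<Rightarrow> real" where
  "bump a b n x = 1 - (1 - (max 0 ((x - a) * (b - x)))\<^sup>2) ^ n"

lemma bump_in_test_functions:
  assumes "0 < a" "a < b" "b < 1"
  shows "bump a b n \<in> test_functions"
proof -
  let ?D = "\<lambda>x. real n * (1 - (max 0 ((x - a) * (b - x)))\<^sup>2) ^ (n - 1) *
      (2 * max 0 ((x - a) * (b - x)) * (a + b - 2 * x))"
  have D: "(bump a b n has_real_derivative ?D x) (at x)" for x
  proof -
    have pow: "((\<lambda>x. 1 - (1 - f x) ^ n) has_real_derivative real n * (1 - f x) ^ (n - 1) * D) (at x)"
      if "(f has_real_derivative D) (at x)" for f D
      using that by (auto intro!: derivative_eq_intros)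
    have "((\<lambda>x. (x - a) * (b - x)) has_real_derivative (a + b - 2 * x)) (at x)"
      by (auto intro!: derivative_eq_intros simp: algebra_simps)
    from DERIV_chain2[OF has_real_derivative_max_0_square this]
    show ?thesis
      unfolding bump_def by (rule pow)
  qed
  have "deriv (bump a b n) = ?D"
    using D by (auto intro!: DERIV_imp_deriv)
  moreover have "continuous_on UNIV ?D"
    by (intro continuous_intros)
  moreover have "bump a b n x = 0" if "x \<notin> {a..b}" for x
  proof -
    have "(x - a) * (b - x) \<le> 0"
      using that assms by (intro mult_le_0_iff[THEN iffD2]) (auto simp: not_le)
    then show ?thesis by (simp add: bump_def max_absorb1)
  qed
  moreover have "\<forall>x. bump a b n field_differentiable at x"
    using D by (auto simp only: field_differentiable_def)
  ultimately show ?thesis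
    unfolding test_functions_def using assms by auto
qed

lemma bump_range:
  assumes "0 < a" "a < b" "b < 1" "x \<in> {0..1}"
  shows "0 \<le> bump a b n x" "bump a b n x \<le> 1"
proof -
  have "max 0 ((x - a) * (b - x)) \<le> 1"
  proof (cases "a \<le> x \<and> x \<le> b")
    case True
    then show ?thesis using assms mult_mono[of "x - a" 1 "b - x" 1] by auto
  next
    case False
    then have "(x - a) * (b - x) \<le> 0"
      using assms by (auto simp: mult_le_0_iff)
    then show ?thesis by simp
  qed
  then have "(max 0 ((x - a) * (b - x)))\<^sup>2 \<le> 1"
    by (simp add: power_le_one)
  then show "0 \<le> bump a b n x" "bump a b n x \<le> 1"
    by (auto simp: bump_def power_le_one)
qed

lemma bump_tendsto:
  assumes "0 < a" "a < b" "b < 1" "x \<in> {0..1}"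
  shows "(\<lambda>n. bump a b n x) \<longlonglongrightarrow> indicator {a<..<b} x"
proof (cases "a < x \<and> x < b")
  case True
  let ?t = "(x - a) * (b - x)"
  have "0 < ?t" using True by simp
  moreover have "?t < 1 * 1"
    using True assms by (intro mult_strict_mono) auto
  ultimately have "\<bar>1 - (max 0 ?t)\<^sup>2\<bar> < 1"
    using power_strict_mono[of ?t 1 2] by (auto simp: max_def abs_if)
  then have "(\<lambda>n. 1 - (1 - (max 0 ?t)\<^sup>2) ^ n) \<longlonglongrightarrow> 1 - 0"
    by (intro tendsto_intros LIMSEQ_power_zero) simp
  then show ?thesis
    using True by (simp add: bump_def)
next
  case False
  then have "(x - a) * (b - x) \<le> 0"
    using assms by (auto simp: mult_le_0_iff)
  then show ?thesis using False by (simp add: bump_def max_absorb1)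
qed

lemma test_function_continuous: "\<psi> \<in> test_functions \<Longrightarrow> continuous_on {0..1} \<psi>"
  unfolding test_functions_def
  by (auto intro!: continuous_at_imp_continuous_on field_differentiable_imp_continuous_at)

text \<open>The fundamental lemma of the calculus of variations: the bumps converge boundedly to
  indicators of intervals compactly contained in (0,1), and these exhaust (0,x), so every primitive
  value of \<open>g\<close> vanishes.\<close>

lemma AE_0_of_test_functions:
  assumes g: "integrable unit_lborel g" and 0: "\<And>\<psi>. \<psi> \<in> test_functions \<Longrightarrow> pairing g \<psi> = 0"
  shows "AE x in unit_lborel. g x = 0"
proof (rule AE_0_of_primitive[OF g])
  fix x :: real assume x: "x \<in> {0..1}"
  have [measurable]: "g \<in> borel_measurable unit_lborel"
    using g by auto
  have ind[measurable]: "indicator A \<in> borel_measurable unit_lborel" if "A \<in> sets borel" for A :: "real set"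
    using that by (intro measurable_restrict_space1) auto
  have int0: "(LINT y|unit_lborel. g y * indicator {a<..<b} y) = 0" if "0 < a" "b < 1" for a b
  proof (cases "a < b")
    case True
    note that = that(1) this that(2)
    have "(\<lambda>n. pairing g (bump a b n)) \<longlonglongrightarrow> (LINT y|unit_lborel. g y * indicator {a<..<b} y)"
      unfolding pairing_def
    proof (rule integral_dominated_convergence[where w = "\<lambda>y. \<bar>g y\<bar>"])
      show "(\<lambda>y. g y * bump a b n y) \<in> borel_measurable unit_lborel" for n
        using continuous_unit_measurable[OF test_function_continuous[OF bump_in_test_functions[OF that]], of n]
        by simp
      show "AE y in unit_lborel. (\<lambda>n. g y * bump a b n y) \<longlonglongrightarrow> g y * indicator {a<..<b} y"
        using bump_tendsto[OF that] by (intro AE_unit_lborelI tendsto_intros)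
      show "AE y in unit_lborel. norm (g y * bump a b n y) \<le> \<bar>g y\<bar>" for n
        using bump_range[OF that] by (intro AE_unit_lborelI) (auto simp: abs_mult mult_left_le)
    qed (use g in auto)
    then show ?thesis
      using 0[OF bump_in_test_functions[OF that]] by (simp add: LIMSEQ_const_iff)
  qed simp
  show "primitive 0 g x = 0"
  proof (cases "x = 0")
    case False
    \<comment> \<open>Moving both ends inwards keeps the interval away from 0, and also from 1 when
      \<open>x = 1\<close>.\<close>
    let ?a = "\<lambda>n. x / (real n + 2)"
    let ?I = "\<lambda>n. indicator {?a n<..<x - ?a n} :: real \<Rightarrow> real"
    have a: "0 < ?a n" "x - ?a n < 1" for n
    proof -
      show "0 < ?a n" using x False by simp
      then show "x - ?a n < 1" using x by simp
    qed
    have lim: "?a \<longlonglongrightarrow> 0"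
      by real_asymp
    have "(\<lambda>n. LINT y|unit_lborel. g y * ?I n y) \<longlonglongrightarrow> (LINT y|unit_lborel. g y * indicator {0<..<x} y)"
    proof (rule integral_dominated_convergence[where w = "\<lambda>y. \<bar>g y\<bar>"])
      show "AE y in unit_lborel. (\<lambda>n. g y * ?I n y) \<longlonglongrightarrow> g y * indicator {0<..<x} y"
      proof (intro AE_unit_lborelI tendsto_intros)
        fix y
        show "(\<lambda>n. ?I n y) \<longlonglongrightarrow> indicator {0<..<x} y"
        proof (cases "0 < y \<and> y < x")
          case True
          have "\<forall>\<^sub>F n in sequentially. ?a n < min y (x - y)"
            using True by (intro order_tendstoD(2)[OF lim]) auto
          then show ?thesis
            using True by (intro tendsto_eventually) (auto elim!: eventually_mono)
        next
          case False
          then have "?I n y = 0" for n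
            using a(1)[of n] by (auto simp: indicator_def)
          then show ?thesis using False by simp
        qed
      qed
    qed (use g ind in \<open>auto simp: abs_mult mult_left_le\<close>)
    then have "(LINT y|unit_lborel. g y * indicator {0<..<x} y) = 0"
      using int0[OF a] by (simp add: LIMSEQ_const_iff)
    moreover have "(LINT y|unit_lborel. indicator {..x} y * g y) = (LINT y|unit_lborel. g y * indicator {0<..<x} y)"
    proof (rule integral_cong_AE)
      show "AE y in unit_lborel. indicator {..x} y * g y = g y * indicator {0<..<x} y"
        unfolding AE_unit_lborel using AE_lborel_singleton[of x] AE_lborel_singleton[of "0::real"]
        by eventually_elim (auto simp: indicator_def)
    qed auto
    ultimately show ?thesis by (simp add: primitive_def)
  qed (simp add: primitive_0)
qed

lemma L2_integrable:
  assumes "g \<in> L2"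
  shows "integrable unit_lborel g"
proof (rule Bochner_Integration.integrable_bound[of _ "\<lambda>x. 1 + (g x)\<^sup>2"])
  show "AE x in unit_lborel. norm (g x) \<le> norm (1 + (g x)\<^sup>2)"
  proof (rule AE_I2)
    fix x
    have "0 \<le> (\<bar>g x\<bar> - 1)\<^sup>2" "0 \<le> (g x)\<^sup>2" by simp_all
    then show "norm (g x) \<le> norm (1 + (g x)\<^sup>2)"
      by (simp add: power2_diff)
  qed
qed (use assms in \<open>auto simp: L2_def\<close>)

lemma H10_weak_deriv:
  assumes "h \<in> H10"
  shows "weak_deriv h \<in> L2" "is_weak_deriv h (weak_deriv h)"
proof -
  have "\<exists>g. g \<in> L2 \<and> is_weak_deriv h g"
    using assms by (auto simp: H10_def)
  then have "weak_deriv h \<in> L2 \<and> is_weak_deriv h (weak_deriv h)"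
    unfolding weak_deriv_def by (rule someI_ex)
  then show "weak_deriv h \<in> L2" "is_weak_deriv h (weak_deriv h)"
    by auto
qed

text \<open>Integration by parts shows that \<open>g\<close> is a weak derivative. Since
  \<open>weak_deriv h\<close> is an arbitrary choice, identifying it with \<open>g\<close> takes the
  uniqueness from \<open>AE_0_of_test_functions\<close>. The function \<open>h\<close> agrees with
  \<open>u\<close> only almost everywhere because semidifferentials determine their elements only up
  to null sets.\<close>

lemma
  assumes h[measurable]: "h \<in> borel_measurable unit_lborel" and hu: "AE x in unit_lborel. h x = u x"
    and u: "\<And>x. x \<in> {0..1} \<Longrightarrow> (u has_real_derivative g x) (at x within {0..1})"
    and g: "continuous_on {0..1} g" and u01: "u 0 = 0" "u 1 = 0"
  shows C1_in_H10: "h \<in> H10" and C1_weak_deriv: "AE x in unit_lborel. weak_deriv h x = g x"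
proof -
  have uc: "continuous_on {0..1} u"
    using DERIV_continuous[OF u] by (simp add: continuous_on_eq_continuous_within)
  note [measurable] = continuous_unit_measurable[OF uc] continuous_unit_measurable[OF g]
  have gL2: "g \<in> L2"
    unfolding L2_def using g by (auto intro!: continuous_unit_integrable continuous_intros)
  have "integrable unit_lborel (\<lambda>x. (h x)\<^sup>2)"
    by (rule integrable_cong_AE_imp[OF continuous_unit_integrable[of "\<lambda>x. (u x)\<^sup>2"]])
      (use uc hu in \<open>auto intro!: continuous_intros elim!: eventually_mono\<close>)
  then have hL2: "h \<in> L2"
    unfolding L2_def by simp
  have wd: "is_weak_deriv h g"
    unfolding is_weak_deriv_def
  proof
    fix \<psi> assume \<psi>: "\<psi> \<in> test_functions"
    have d\<psi>: "(\<psi> has_real_derivative deriv \<psi> x) (at x)" for x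
      using \<psi> by (simp add: test_functions_def DERIV_deriv_iff_field_differentiable)
    have c: "continuous_on {0..1} (deriv \<psi>)" "continuous_on {0..1} \<psi>"
      using \<psi> test_function_continuous[OF \<psi>] by (auto simp: test_functions_def intro: continuous_on_subset)
    note [measurable] = continuous_unit_measurable[OF c(1)] continuous_unit_measurable[OF c(2)]
    have "pairing h (deriv \<psi>) = (LINT x|unit_lborel. u x * deriv \<psi> x)"
      unfolding pairing_def using hu by (auto intro!: integral_cong_AE elim!: eventually_mono)
    also have "(LINT x|unit_lborel. u x * deriv \<psi> x + g x * \<psi> x) = u 1 * \<psi> 1 - u 0 * \<psi> 0"
    proof (rule LINT_unit_FTC)
      show "((\<lambda>x. u x * \<psi> x) has_real_derivative u x * deriv \<psi> x + g x * \<psi> x) (at x within {0..1})"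
        if "x \<in> {0..1}" for x
        using DERIV_mult[OF u[OF that] has_field_derivative_at_within[OF d\<psi>]] by (simp add: add.commute mult.commute)
    qed (use g uc c in \<open>auto intro!: continuous_intros\<close>)
    then have "(LINT x|unit_lborel. u x * deriv \<psi> x) = - pairing g \<psi>"
      unfolding pairing_def using u01 g uc c
      by (subst (asm) Bochner_Integration.integral_add) (auto intro!: continuous_unit_integrable continuous_intros)
    finally show "pairing h (deriv \<psi>) = - pairing g \<psi>" .
  qed
  show "h \<in> H10"
    unfolding H10_def using hL2 gL2 wd hu uc u01 by blast
  note wdh = H10_weak_deriv[OF \<open>h \<in> H10\<close>]
  have "AE x in unit_lborel. weak_deriv h x - g x = 0"
  proof (rule AE_0_of_test_functions)
    fix \<psi> assume \<psi>: "\<psi> \<in> test_functions"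
    have int: "integrable unit_lborel (\<lambda>x. f x * \<psi> x)" if "f \<in> L2" for f
    proof -
      have "compact (\<psi> ` {0..1})"
        using test_function_continuous[OF \<psi>] by (intro compact_continuous_image) auto
      then obtain B where B: "\<And>x. x \<in> {0..1} \<Longrightarrow> \<bar>\<psi> x\<bar> \<le> B"
        using compact_imp_bounded bounded_iff by (metis imageI real_norm_def)
      have [measurable]: "f \<in> borel_measurable unit_lborel" "\<psi> \<in> borel_measurable unit_lborel"
        using that continuous_unit_measurable[OF test_function_continuous[OF \<psi>]] by (auto simp: L2_def)
      show ?thesis
      proof (rule Bochner_Integration.integrable_bound)
        show "integrable unit_lborel (\<lambda>x. f x * B)"
          using L2_integrable[OF that] by simp
        show "AE x in unit_lborel. norm (f x * \<psi> x) \<le> norm (f x * B)"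
          using B by (intro AE_unit_lborelI) (force simp: abs_mult intro!: mult_left_mono)
      qed measurable
    qed
    have "pairing (weak_deriv h) \<psi> = pairing g \<psi>"
      using wdh wd \<psi> unfolding is_weak_deriv_def by fastforce
    then show "pairing (\<lambda>x. weak_deriv h x - g x) \<psi> = 0"
      using int[of g] int[of "weak_deriv h"] wdh gL2 by (simp add: pairing_def left_diff_distrib)
  qed (use L2_integrable wdh gL2 in auto)
  then show "AE x in unit_lborel. weak_deriv h x = g x"
    by eventually_elim simp
qed

section \<open>The logistic function and the entropy\<close>

text \<open>It plays two roles: it is the derivative of \<open>ln (1 + exp u)\<close> and the
  inverse of the logit s'(a) = ln a - ln (1 - a).\<close>

definition logistic :: "real \<Rightarrow> real" where
  "logistic u = 1 / (1 + exp (- u))"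

lemma logistic_bounds: "0 < logistic u" "logistic u < 1"
  by (auto simp: logistic_def add_pos_pos)

lemma logistic_altdef: "logistic u = exp u / (1 + exp u)"
  by (simp add: logistic_def exp_minus field_simps add_pos_pos add_nonneg_eq_0_iff)

lemma one_minus_logistic: "1 - logistic u = 1 / (1 + exp u)"
  unfolding logistic_altdef using exp_gt_zero[of u] by (simp add: field_simps add_pos_pos del: exp_gt_zero)

lemma logit_logistic: "ln (logistic u) - ln (1 - logistic u) = u"
proof -
  have "0 < 1 + exp u"
    by (simp add: add_pos_pos)
  then have "ln (exp u / (1 + exp u)) = u - ln (1 + exp u)" "ln (1 / (1 + exp u)) = - ln (1 + exp u)"
    by (simp_all add: ln_div)
  then show ?thesis
    unfolding one_minus_logistic unfolding logistic_altdef by simp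
qed

lemma logistic_logit: "0 < b \<Longrightarrow> b < 1 \<Longrightarrow> logistic (ln b - ln (1 - b)) = b"
  unfolding logistic_altdef by (simp add: exp_diff field_simps)

lemma logistic_has_derivative [derivative_intros]:
  assumes "(f has_real_derivative D) (at x within S)"
  shows "((\<lambda>x. logistic (f x)) has_real_derivative logistic (f x) * (1 - logistic (f x)) * D) (at x within S)"
proof -
  have "1 + exp (- f x) \<noteq> 0"
    using exp_gt_zero[of "- f x"] by linarith
  then show ?thesis
    unfolding logistic_def
    by (auto intro!: derivative_eq_intros assms simp: field_simps power2_eq_square)
qed

lemma logistic_mono: "u \<le> v \<Longrightarrow> logistic u \<le> logistic v"
  unfolding logistic_def by (intro divide_left_mono) (auto simp: add_pos_pos)

lemma logistic_lipschitz: "\<bar>logistic u - logistic v\<bar> \<le> \<bar>u - v\<bar>"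
proof -
  have "norm (logistic u - logistic v) \<le> 1 * norm (u - v)"
  proof (rule field_differentiable_bound[of UNIV])
    fix z
    show "(logistic has_field_derivative logistic z * (1 - logistic z) * 1) (at z within UNIV)"
      by (auto intro!: derivative_eq_intros)
    show "norm (logistic z * (1 - logistic z) * 1) \<le> 1"
      using logistic_bounds[of z] by (auto simp: abs_mult intro!: mult_le_one)
  qed auto
  then show ?thesis by simp
qed

lemma continuous_on_logistic [continuous_intros]:
  "continuous_on S f \<Longrightarrow> continuous_on S (\<lambda>x. logistic (f x))"
  unfolding logistic_def by (intro continuous_intros) (auto simp: add_pos_pos less_imp_neq[symmetric])

lemma borel_measurable_logistic [measurable]: "logistic \<in> borel_measurable borel"
  unfolding logistic_def[abs_def] by measurable

text \<open>Jensen's inequality for exp under the law with value \<open>b - a\<close> with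
  probability \<open>logistic a\<close> and 0 otherwise: \<open>m\<close> is its mean and
  \<open>(1 + exp b) / (1 + exp a)\<close> its exponential moment.\<close>

lemma ln_1_plus_exp_above_tangent:
  "ln (1 + exp a) + logistic a * (b - a) \<le> ln (1 + exp b)"
proof -
  define m where "m = logistic a * (b - a)"
  have "1 = (1 - logistic a) * (1 - m) + logistic a * (1 + ((b - a) - m))"
    by (simp add: m_def algebra_simps)
  also have "\<dots> \<le> (1 - logistic a) * exp (- m) + logistic a * exp ((b - a) - m)"
    using logistic_bounds[of a] exp_ge_add_one_self[of "- m"] exp_ge_add_one_self[of "(b - a) - m"]
    by (intro add_mono mult_left_mono) auto
  also have "\<dots> = exp (- m) * ((1 - logistic a) + logistic a * exp (b - a))"
    using exp_add[of "- m" "b - a"] by (simp only: add.commute[of "- m"] diff_conv_add_uminus) (simp add: ring_distribs add_ac)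
  also have "(1 - logistic a) + logistic a * exp (b - a) = (1 + exp b) / (1 + exp a)"
    unfolding one_minus_logistic unfolding logistic_altdef
    by (simp add: exp_diff add_divide_distrib)
  finally have "exp m * (1 + exp a) \<le> 1 + exp b"
    by (simp add: exp_minus field_simps add_pos_pos)
  then have "ln (exp m * (1 + exp a)) \<le> ln (1 + exp b)"
    by (subst ln_le_cancel_iff) (auto simp: add_pos_pos)
  then show ?thesis
    unfolding m_def[symmetric] by (simp add: ln_mult add_pos_pos add_nonneg_eq_0_iff)
qed

lemma continuous_on_x_ln_x: "continuous_on {0..} (\<lambda>x::real. x * ln x)"
  unfolding continuous_on_eq_continuous_within
proof
  fix x :: real assume "x \<in> {0..}"
  show "continuous (at x within {0..}) (\<lambda>x. x * ln x)"
  proof (cases "x = 0")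
    case True
    have "((\<lambda>x::real. x * ln x) \<longlongrightarrow> 0) (at_right 0)"
      by real_asymp
    then show ?thesis
      using True by (simp add: continuous_within at_within_Ici_at_right)
  qed (auto intro!: continuous_intros)
qed

lemma continuous_on_entropy_s: "continuous_on {0..1} entropy_s"
  unfolding entropy_s_def
  by (intro continuous_on_add continuous_on_subset[OF continuous_on_x_ln_x]
      continuous_on_compose2[OF continuous_on_x_ln_x, of _ "\<lambda>x. 1 - x"] continuous_intros) auto

lemma borel_measurable_entropy_s [measurable]: "entropy_s \<in> borel_measurable borel"
  unfolding entropy_s_def[abs_def] by measurable

lemma entropy_s_bounded: "\<exists>B. \<forall>a\<in>{0..1}. \<bar>entropy_s a\<bar> \<le> B"
  using compact_imp_bounded[OF compact_continuous_image[OF continuous_on_entropy_s compact_Icc]]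
  unfolding bounded_iff by auto

text \<open>The Kullback-Leibler divergence between the Bernoulli laws of parameters
  \<open>a\<close> and \<open>b\<close>, in its form as Bregman divergence of s.\<close>

definition bregman :: "real \<Rightarrow> real \<Rightarrow> real" where
  "bregman a b = entropy_s a - entropy_s b - (ln b - ln (1 - b)) * (a - b)"

lemma mult_ln_diff_ge:
  fixes a b :: real
  assumes "0 \<le> a" "0 < b"
  shows "a - b \<le> a * ln a - a * ln b" and "a * ln a - a * ln b = a - b \<Longrightarrow> a = b"
proof -
  have "a - b \<le> a * ln a - a * ln b \<and> (a * ln a - a * ln b = a - b \<longrightarrow> a = b)"
  proof (cases "a = 0")
    case False
    then have a: "0 < a" using assms by simp
    have *: "a * ln a - a * ln b = - (a * ln (b / a))" "a - b = - (a * (b / a - 1))"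
      using a assms by (auto simp: ln_div algebra_simps)
    have "ln (b / a) \<le> b / a - 1"
      using a assms by (intro ln_le_minus_one) auto
    moreover have "b / a = 1" if "ln (b / a) = b / a - 1"
      using ln_eq_minus_one[OF _ that] a assms by auto
    ultimately show ?thesis
      unfolding * using a by auto
  qed (use assms in auto)
  then show "a - b \<le> a * ln a - a * ln b" and "a * ln a - a * ln b = a - b \<Longrightarrow> a = b"
    by auto
qed

text \<open>Two instances of \<open>mult_ln_diff_ge\<close>, at (a, b) and at (1 - a, 1 - b), whose
  lower bounds add up to 0. The first argument may touch 0 and 1, as \<epsilon> times an admissible
  density may; the second will be a value of \<open>logistic\<close>.\<close>

lemma
  assumes "a \<in> {0..1}" "0 < b" "b < 1"
  shows bregman_nonneg: "0 \<le> bregman a b" and bregman_eq_0: "bregman a b = 0 \<Longrightarrow> a = b"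
proof -
  have *: "bregman a b = (a * ln a - a * ln b) + ((1 - a) * ln (1 - a) - (1 - a) * ln (1 - b))"
    by (simp add: bregman_def entropy_s_def algebra_simps)
  show "0 \<le> bregman a b"
    unfolding * using mult_ln_diff_ge(1)[of a b] mult_ln_diff_ge(1)[of "1 - a" "1 - b"] assms by simp
  show "bregman a b = 0 \<Longrightarrow> a = b"
    unfolding * using mult_ln_diff_ge[of a b] mult_ln_diff_ge(1)[of "1 - a" "1 - b"] assms by simp
qed

text \<open>The symmetrized divergence equals (s'(b) - s'(a)) (b - a), and each of the two
  logarithms in s' contributes 1/\<eta> to its Lipschitz constant; the divergence in the other order
  is dropped, being nonnegative.\<close>

lemma bregman_le:
  assumes "0 < \<eta>" "a \<in> {\<eta>..1 - \<eta>}" "b \<in> {\<eta>..1 - \<eta>}"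
  shows "bregman b a \<le> 2 / \<eta> * (b - a)\<^sup>2"
proof -
  have *: "(ln y - ln (1 - y)) - (ln x - ln (1 - x)) \<le> 2 / \<eta> * (y - x)"
    if "x \<le> y" "x \<in> {\<eta>..1 - \<eta>}" "y \<in> {\<eta>..1 - \<eta>}" for x y
  proof -
    have pos: "0 < x" "0 < y" "0 < 1 - x" "0 < 1 - y" "\<eta> \<le> x" "\<eta> \<le> 1 - y"
      using that assms(1) by auto
    have 1: "ln y - ln x \<le> (y - x) / \<eta>"
    proof -
      have "ln y - ln x = ln (y / x)" using pos by (simp add: ln_div)
      also have "\<dots> \<le> (y - x) / x" using ln_le_minus_one[of "y / x"] pos by (simp add: diff_divide_distrib)
      also have "\<dots> \<le> (y - x) / \<eta>" using pos that assms(1) by (intro divide_left_mono) auto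
      finally show ?thesis .
    qed
    have 2: "ln (1 - x) - ln (1 - y) \<le> (y - x) / \<eta>"
    proof -
      have "ln (1 - x) - ln (1 - y) = ln ((1 - x) / (1 - y))" using pos by (simp add: ln_div)
      also have "\<dots> \<le> (1 - x) / (1 - y) - 1" using pos by (intro ln_le_minus_one) auto
      also have "\<dots> = (y - x) / (1 - y)" using pos by (simp add: field_simps)
      also have "\<dots> \<le> (y - x) / \<eta>" using pos that assms(1) by (intro divide_left_mono) auto
      finally show ?thesis .
    qed
    have "2 / \<eta> * (y - x) = (y - x) / \<eta> + (y - x) / \<eta>"
      by simp
    then show ?thesis using 1 2 by linarith
  qed
  have "bregman b a + bregman a b = ((ln b - ln (1 - b)) - (ln a - ln (1 - a))) * (b - a)"
    by (simp add: bregman_def algebra_simps)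
  moreover have "0 \<le> bregman a b"
    using assms by (intro bregman_nonneg) auto
  moreover have "((ln b - ln (1 - b)) - (ln a - ln (1 - a))) * (b - a) \<le> 2 / \<eta> * (b - a)\<^sup>2"
  proof (cases "a \<le> b")
    case True
    then show ?thesis
      using mult_right_mono[OF *[OF True assms(2,3)], of "b - a"] by (simp only: power2_eq_square mult.assoc)
  next
    case False
    then have "((ln a - ln (1 - a)) - (ln b - ln (1 - b))) * (a - b) \<le> 2 / \<eta> * (a - b) * (a - b)"
      using mult_right_mono[OF *[of b a], of "a - b"] assms by simp
    moreover have "((ln b - ln (1 - b)) - (ln a - ln (1 - a))) * (b - a) = ((ln a - ln (1 - a)) - (ln b - ln (1 - b))) * (a - b)"
      by (simp add: algebra_simps)
    moreover have "(b - a)\<^sup>2 = (a - b) * (a - b)"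
      by (simp add: power2_eq_square algebra_simps)
    ultimately show ?thesis by (simp only: mult.assoc)
  qed
  ultimately show ?thesis by linarith
qed

text \<open>The logit of \<open>logistic (u x)\<close> is \<open>u x\<close>, so the linear term
  contains no logarithm.\<close>

lemma continuous_on_bregman_logistic:
  assumes "continuous_on {0..1} f" "f ` {0..1} \<subseteq> {0..1}" "continuous_on {0..1} u"
  shows "continuous_on {0..1::real} (\<lambda>x. bregman (f x) (logistic (u x)))"
proof -
  have "bregman (f x) (logistic (u x)) = entropy_s (f x) - entropy_s (logistic (u x)) - u x * (f x - logistic (u x))" for x
    by (simp add: bregman_def logit_logistic)
  moreover have "logistic (u x) \<in> {0..1}" for x
    using logistic_bounds[of "u x"] by simp
  ultimately show ?thesis
    using assms by (auto intro!: continuous_intros continuous_on_compose2[OF continuous_on_entropy_s])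
qed

lemma integrable_entropy_s:
  assumes [measurable]: "f \<in> borel_measurable unit_lborel" and "AE x in unit_lborel. 0 \<le> f x \<and> f x \<le> 1"
  shows "integrable unit_lborel (\<lambda>x. entropy_s (f x))"
proof -
  obtain B where "\<forall>a\<in>{0..1}. \<bar>entropy_s a\<bar> \<le> B"
    using entropy_s_bounded by blast
  then show ?thesis
    by (intro bounded_unit_integrable[of _ B] eventually_mono[OF assms(2)]) auto
qed

section \<open>Minimizers of the trial functional\<close>

lemma profiles_measurable: "\<rho> \<in> profiles \<Longrightarrow> \<rho> \<in> borel_measurable unit_lborel"
  by (auto simp: profiles_def Linf_def)

lemma profiles_range: "\<rho> \<in> profiles \<Longrightarrow> AE x in unit_lborel. 0 \<le> \<rho> x \<and> \<rho> x \<le> 1"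
  by (auto simp: profiles_def)

lemma profiles_integrable: "\<rho> \<in> profiles \<Longrightarrow> integrable unit_lborel \<rho>"
  using profiles_range[of \<rho>] by (intro bounded_unit_integrable[of _ 1] profiles_measurable) auto

lemma dphi_unique:
  assumes "has_dphi c \<phi> \<mu>"
  shows "dphi c \<phi> = \<mu>"
  unfolding dphi_def
proof (rule the_equality[where P = "has_dphi c \<phi>", OF assms])
  fix \<nu> assume "has_dphi c \<phi> \<nu>"
  then show "\<nu> = \<mu>"
    using assms by (intro unit_measure_eqI) (auto simp: has_dphi_def)
qed

text \<open>By \<open>eps_small\<close> the mean of \<open>\<epsilon> \<phi>\<^sub>x\<close> is
  below 1, so its logit is finite.\<close>

locale quasi_potential_data =
  fixes \<phi>0 \<phi>1 \<epsilon> :: real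
  assumes eps_pos: "0 < \<epsilon>" and phi_less: "\<phi>0 < \<phi>1" and eps_small: "\<epsilon> * (\<phi>1 - \<phi>0) < 1"
begin

text \<open>These densities replace the functions \<phi> from here on: the finite values of
  \<open>trial_G\<close> at a measurable profile are those of \<open>G\<close> on this set.\<close>

definition densities :: "(real \<Rightarrow> real) set" where
  "densities = {p \<in> borel_measurable unit_lborel.
     (AE x in unit_lborel. 0 \<le> p x \<and> p x \<le> 1 / \<epsilon>) \<and> (LINT x|unit_lborel. p x) = \<phi>1 - \<phi>0}"

definition G :: "(real \<Rightarrow> real) \<Rightarrow> (real \<Rightarrow> real) \<Rightarrow> real" where
  "G \<rho> p = (LINT x|unit_lborel. entropy_s (\<rho> x) + entropy_s (\<epsilon> * p x)
     + (1 - \<rho> x) * primitive \<phi>0 p x - ln (1 + exp (primitive \<phi>0 p x)))"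

lemma
  assumes "p \<in> densities"
  shows densities_measurable: "p \<in> borel_measurable unit_lborel"
    and densities_range: "AE x in unit_lborel. 0 \<le> p x \<and> p x \<le> 1 / \<epsilon>"
    and densities_LINT: "(LINT x|unit_lborel. p x) = \<phi>1 - \<phi>0"
    and densities_abs_le: "AE x in unit_lborel. \<bar>p x\<bar> \<le> 1 / \<epsilon>"
    and densities_integrable: "integrable unit_lborel p"
proof -
  show *: "p \<in> borel_measurable unit_lborel" "AE x in unit_lborel. 0 \<le> p x \<and> p x \<le> 1 / \<epsilon>"
    "(LINT x|unit_lborel. p x) = \<phi>1 - \<phi>0"
    using assms by (auto simp: densities_def)
  then show "AE x in unit_lborel. \<bar>p x\<bar> \<le> 1 / \<epsilon>"
    by auto
  then show "integrable unit_lborel p"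
    using * by (intro bounded_unit_integrable[of p "1 / \<epsilon>"])
qed

lemma primitive_continuous: "p \<in> densities \<Longrightarrow> continuous_on {0..1} (primitive c p)"
  by (rule continuous_on_primitive[OF densities_measurable densities_abs_le])

text \<open>Radon-Nikodym: absolute continuity excludes an atom at 0, and \<phi> is recovered as the
  primitive of its density. Together with \<open>primitive_trial_G\<close> this turns the infimum
  over \<open>phi_space\<close> into one over \<open>densities\<close>.\<close>

lemma trial_G_cases:
  assumes "\<phi> \<in> phi_space \<phi>0 \<phi>1"
  shows "trial_G \<epsilon> \<phi>0 \<rho> \<phi> = \<infinity> \<or> (\<exists>p\<in>densities. trial_G \<epsilon> \<phi>0 \<rho> \<phi> = ereal (G \<rho> p))"
proof (cases "absolutely_continuous unit_lborel (dphi \<phi>0 \<phi>) \<and> (AE x in unit_lborel. phi_x \<phi>0 \<phi> x \<le> 1 / \<epsilon>)")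
  case True
  obtain \<mu> where \<mu>: "has_dphi \<phi>0 \<phi> \<mu>" "measure \<mu> {0..1} = \<phi>1 - \<phi>0"
    using assms by (auto simp: phi_space_def)
  note d = dphi_unique[OF \<mu>(1)]
  have sets: "sets \<mu> = sets unit_lborel"
    using \<mu>(1) sets_restrict_space_cong[OF sets_lborel, of "{0..1}"] by (metis has_dphi_def)
  interpret \<mu>: finite_measure \<mu>
    using \<mu>(1) by (simp add: has_dphi_def)
  let ?p = "phi_x \<phi>0 \<phi>"
  have ac: "absolutely_continuous unit_lborel \<mu>" using True d by simp
  have p[measurable]: "?p \<in> borel_measurable unit_lborel"
    unfolding phi_x_def[abs_def] by measurable
  have range: "AE x in unit_lborel. 0 \<le> ?p x \<and> ?p x \<le> 1 / \<epsilon>"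
    using True by (auto simp: phi_x_def)
  then have pint: "integrable unit_lborel ?p"
    by (intro bounded_unit_integrable[OF p, of "1 / \<epsilon>"]) auto
  \<comment> \<open>Finiteness matters because \<open>phi_x\<close> passes through
    \<open>enn2real\<close>, which sends \<infinity> to 0.\<close>
  have "AE x in unit_lborel. RN_deriv unit_lborel \<mu> x \<noteq> \<infinity>"
    using unit_lborel.RN_deriv_finite[OF _ ac sets] \<mu>.sigma_finite_measure_axioms by blast
  then have "density unit_lborel (\<lambda>x. ennreal (?p x)) = density unit_lborel (RN_deriv unit_lborel \<mu>)"
    by (intro density_cong) (auto simp: phi_x_def d less_top elim!: eventually_mono)
  also have "\<dots> = \<mu>"
    by (rule unit_lborel.density_RN_deriv[OF ac sets])
  finally have "measure \<mu> {0..x} = primitive 0 ?p x" if "x \<in> {0..1}" for x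
    using density_measure_atMost(2)[OF pint _ that] range by auto
  then have "\<And>x. x \<in> {0..1} \<Longrightarrow> \<phi> x = primitive \<phi>0 ?p x" "primitive 0 ?p 1 = \<phi>1 - \<phi>0"
    using \<mu> by (auto simp: has_dphi_def primitive_def)
  then have "?p \<in> densities" "trial_G \<epsilon> \<phi>0 \<rho> \<phi> = ereal (G \<rho> ?p)"
    using p range True
    by (auto simp: densities_def primitive_1 trial_G_def G_def intro!: Bochner_Integration.integral_cong)
  then show ?thesis by blast
qed (auto simp: trial_G_def)

lemma primitive_trial_G:
  assumes p: "p \<in> densities" and [measurable]: "\<rho> \<in> borel_measurable unit_lborel"
  shows "primitive \<phi>0 p \<in> phi_space \<phi>0 \<phi>1" and "trial_G \<epsilon> \<phi>0 \<rho> (primitive \<phi>0 p) = ereal (G \<rho> p)"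
proof -
  note [measurable] = densities_measurable[OF p] continuous_unit_measurable[OF primitive_continuous[OF p]]
  let ?\<mu> = "density unit_lborel (\<lambda>x. ennreal (p x))"
  have nn: "AE x in unit_lborel. 0 \<le> p x"
    using densities_range[OF p] by auto
  note m = density_measure_atMost[OF densities_integrable[OF p] nn]
  have \<mu>: "has_dphi \<phi>0 (primitive \<phi>0 p) ?\<mu>"
    unfolding has_dphi_def using m(1)[of 0] m(2) sets_restrict_space_cong[OF sets_lborel, of "{0..1}"]
    by (simp add: primitive_def)
  moreover have "measure ?\<mu> {0..1} = \<phi>1 - \<phi>0"
    using m(2)[of 1] densities_LINT[OF p] by (simp add: primitive_1)
  ultimately show "primitive \<phi>0 p \<in> phi_space \<phi>0 \<phi>1"
    by (auto simp: phi_space_def)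
  have px: "AE x in unit_lborel. phi_x \<phi>0 (primitive \<phi>0 p) x = p x"
    using unit_lborel.RN_deriv_unique[of "\<lambda>x. ennreal (p x)" ?\<mu>, OF _ refl, simplified] nn
    unfolding phi_x_def dphi_unique[OF \<mu>]
    by eventually_elim (metis enn2real_ennreal)
  then have "AE x in unit_lborel. phi_x \<phi>0 (primitive \<phi>0 p) x \<le> 1 / \<epsilon>"
    using densities_range[OF p] by eventually_elim simp
  moreover have "absolutely_continuous unit_lborel ?\<mu>"
    by (rule absolutely_continuousI_density) measurable
  moreover
  have [measurable]: "phi_x \<phi>0 (primitive \<phi>0 p) \<in> borel_measurable unit_lborel"
    unfolding phi_x_def[abs_def] by measurable
  moreover have "(LINT x|unit_lborel. entropy_s (\<rho> x) + entropy_s (\<epsilon> * phi_x \<phi>0 (primitive \<phi>0 p) x)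
      + (1 - \<rho> x) * primitive \<phi>0 p x - ln (1 + exp (primitive \<phi>0 p x))) = G \<rho> p"
    unfolding G_def
  proof (rule integral_cong_AE)
    show "AE x in unit_lborel. entropy_s (\<rho> x) + entropy_s (\<epsilon> * phi_x \<phi>0 (primitive \<phi>0 p) x)
        + (1 - \<rho> x) * primitive \<phi>0 p x - ln (1 + exp (primitive \<phi>0 p x)) =
      entropy_s (\<rho> x) + entropy_s (\<epsilon> * p x) + (1 - \<rho> x) * primitive \<phi>0 p x - ln (1 + exp (primitive \<phi>0 p x))"
      using px by eventually_elim simp
  qed measurable
  ultimately show "trial_G \<epsilon> \<phi>0 \<rho> (primitive \<phi>0 p) = ereal (G \<rho> p)"
    by (simp add: trial_G_def dphi_unique[OF \<mu>])
qed

text \<open>The Lipschitz constant is the one that the Euler-Lagrange equation gives for \<open>\<phi>\<^sub>x\<close>. Unlike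
  the set of solutions of that equation, this set is convex; it is compact in the uniform norm.\<close>

definition lip_densities :: "(real \<Rightarrow> real) set" where
  "lip_densities = {w. (\<forall>x\<in>{0..1}. \<forall>y\<in>{0..1}. \<bar>w x - w y\<bar> \<le> \<bar>x - y\<bar> / \<epsilon>\<^sup>2) \<and>
     (\<forall>x\<in>{0..1}. 0 \<le> w x \<and> w x \<le> 1 / \<epsilon>) \<and> (LINT x|unit_lborel. w x) = \<phi>1 - \<phi>0}"

lemma lip_densities_continuous: "w \<in> lip_densities \<Longrightarrow> continuous_on {0..1} w"
  using eps_pos
  by (intro lipschitz_on_continuous_on[of "1 / \<epsilon>\<^sup>2"] lipschitz_onI) (auto simp: lip_densities_def dist_real_def)

lemma lip_densities_range: "w \<in> lip_densities \<Longrightarrow> x \<in> {0..1} \<Longrightarrow> 0 \<le> w x" "w \<in> lip_densities \<Longrightarrow> x \<in> {0..1} \<Longrightarrow> w x \<le> 1 / \<epsilon>"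
  by (auto simp: lip_densities_def)

lemma lip_densities_subset_densities: "lip_densities \<subseteq> densities"
  unfolding densities_def using continuous_unit_measurable[OF lip_densities_continuous]
  by (auto simp: lip_densities_def intro!: AE_unit_lborelI)

definition E :: "(real \<Rightarrow> real) \<Rightarrow> real" where
  "E \<rho> = (LINT x|unit_lborel. entropy_s (\<rho> x))"

definition C :: "(real \<Rightarrow> real) \<Rightarrow> real" where
  "C p = (LINT x|unit_lborel. entropy_s (\<epsilon> * p x) + primitive \<phi>0 p x - ln (1 + exp (primitive \<phi>0 p x)))"

lemma integrable_entropy_s_density:
  assumes p: "p \<in> densities"
  shows "integrable unit_lborel (\<lambda>x. entropy_s (\<epsilon> * p x))"
proof -
  note [measurable] = densities_measurable[OF p]
  show ?thesis
    using densities_range[OF p] eps_pos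
    by (intro integrable_entropy_s) (auto elim!: eventually_mono simp: field_simps)
qed

lemma C_integrable:
  assumes p: "p \<in> densities"
  shows "integrable unit_lborel (\<lambda>x. entropy_s (\<epsilon> * p x) + primitive \<phi>0 p x - ln (1 + exp (primitive \<phi>0 p x)))"
proof -
  have "continuous_on {0..1} (\<lambda>x. ln (1 + exp (primitive \<phi>0 p x)))"
    by (intro continuous_intros primitive_continuous p) (auto simp: add_pos_pos less_imp_neq[symmetric])
  then show ?thesis
    using integrable_entropy_s_density[OF p]
    by (intro Bochner_Integration.integrable_diff Bochner_Integration.integrable_add)
      (auto intro!: continuous_unit_integrable primitive_continuous p)
qed

lemma G_eq:
  assumes \<rho>: "\<rho> \<in> profiles" and p: "p \<in> densities"
  shows "G \<rho> p = E \<rho> + C p - pairing \<rho> (primitive \<phi>0 p)"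
proof -
  have "AE x in unit_lborel. \<bar>\<rho> x\<bar> \<le> 1"
    using profiles_range[OF \<rho>] by eventually_elim auto
  then have "integrable unit_lborel (\<lambda>x. \<rho> x * primitive \<phi>0 p x)"
    by (intro bounded_mult_integrable profiles_measurable \<rho> continuous_unit_integrable primitive_continuous p)
  moreover have "integrable unit_lborel (\<lambda>x. entropy_s (\<rho> x))"
    using integrable_entropy_s profiles_measurable[OF \<rho>] profiles_range[OF \<rho>] by auto
  ultimately have "E \<rho> + C p - pairing \<rho> (primitive \<phi>0 p) =
     (LINT x|unit_lborel. entropy_s (\<rho> x) + (entropy_s (\<epsilon> * p x) + primitive \<phi>0 p x
        - ln (1 + exp (primitive \<phi>0 p x))) - \<rho> x * primitive \<phi>0 p x)"
    unfolding E_def C_def pairing_def using C_integrable[OF p]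
    by (subst Bochner_Integration.integral_diff, simp_all)
  also have "\<dots> = G \<rho> p"
    unfolding G_def by (intro Bochner_Integration.integral_cong) (auto simp: algebra_simps)
  finally show ?thesis by simp
qed

text \<open>The Euler-Lagrange equation says that the logit of \<open>\<epsilon> \<phi>\<^sub>x\<close> has derivative \<open>drift \<rho> \<phi>\<^sub>x\<close>.\<close>

definition drift :: "(real \<Rightarrow> real) \<Rightarrow> (real \<Rightarrow> real) \<Rightarrow> real \<Rightarrow> real" where
  "drift \<rho> p x = (1 - logistic (primitive \<phi>0 p x) - \<rho> x) / \<epsilon>"

section \<open>The descent step given by the tangent-line problem\<close>

lemma
  assumes \<rho>: "\<rho> \<in> profiles" and p: "p \<in> densities"
  shows drift_measurable: "drift \<rho> p \<in> borel_measurable unit_lborel"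
    and drift_abs_le: "AE x in unit_lborel. \<bar>drift \<rho> p x\<bar> \<le> 1 / \<epsilon>"
proof -
  note [measurable] = profiles_measurable[OF \<rho>] continuous_unit_measurable[OF primitive_continuous[OF p]]
  show "drift \<rho> p \<in> borel_measurable unit_lborel"
    unfolding drift_def[abs_def] by measurable
  show "AE x in unit_lborel. \<bar>drift \<rho> p x\<bar> \<le> 1 / \<epsilon>"
    using profiles_range[OF \<rho>]
  proof eventually_elim
    case (elim x)
    then have "\<bar>1 - logistic (primitive \<phi>0 p x) - \<rho> x\<bar> \<le> 1"
      using logistic_bounds[of "primitive \<phi>0 p x"] by auto
    then show ?case
      using eps_pos by (auto simp: drift_def abs_divide divide_right_mono)
  qed
qed

text \<open>The constant \<open>c\<close> is the Lagrange multiplier of the mass constraint, found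
  by the intermediate value theorem. The Lipschitz bound combines the bound 1/\<epsilon> on the
  drift, the 1-Lipschitz function \<open>logistic\<close> and the division by \<epsilon>.\<close>

lemma logistic_primitive_in_lip_densities:
  assumes \<rho>: "\<rho> \<in> profiles" and p: "p \<in> densities"
  obtains c where "(\<lambda>x. logistic (primitive c (drift \<rho> p) x) / \<epsilon>) \<in> lip_densities"
proof -
  let ?r = "primitive 0 (drift \<rho> p)" and ?\<theta> = "\<epsilon> * (\<phi>1 - \<phi>0)"
  note k = drift_measurable[OF \<rho> p] drift_abs_le[OF \<rho> p]
  have rc: "continuous_on {0..1} ?r"
    by (rule continuous_on_primitive[OF k])
  have rb: "\<bar>?r x\<bar> \<le> 1 / \<epsilon>" if "x \<in> {0..1}" for x
  proof -
    have "\<bar>?r x - ?r 0\<bar> \<le> 1 / \<epsilon> * \<bar>x - 0\<bar>"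
      by (rule primitive_abs_diff_le[OF k that]) simp
    also have "\<dots> \<le> 1 / \<epsilon>"
      using that eps_pos by (simp add: divide_le_cancel)
    finally show ?thesis by (simp add: primitive_0)
  qed
  have \<theta>: "0 < ?\<theta>" "?\<theta> < 1"
    using eps_pos phi_less eps_small by auto
  \<comment> \<open>This is the multiplier for zero drift. As \<open>?r\<close> is bounded by
    1/\<epsilon>, shifting it by 1/\<epsilon> down or up makes the integrand lie below or above
    \<open>?\<theta>\<close> everywhere, which brackets the root.\<close>
  define \<kappa> where "\<kappa> = ln ?\<theta> - ln (1 - ?\<theta>)"
  have \<kappa>: "logistic \<kappa> = ?\<theta>"
    unfolding \<kappa>_def using \<theta> by (rule logistic_logit)
  let ?g = "\<lambda>c. LINT x|unit_lborel. logistic (c + ?r x)"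
  have int: "integrable unit_lborel (\<lambda>x. logistic (c + ?r x))" for c
    by (intro continuous_unit_integrable continuous_intros rc)
  have lip: "\<bar>?g c - ?g d\<bar> \<le> \<bar>c - d\<bar>" for c d
  proof -
    have "?g c - ?g d = (LINT x|unit_lborel. logistic (c + ?r x) - logistic (d + ?r x))"
      by (simp add: int)
    also have "\<bar>\<dots>\<bar> \<le> \<bar>c - d\<bar>"
    proof (intro LINT_unit_abs_le AE_I2)
      show "\<bar>logistic (c + ?r x) - logistic (d + ?r x)\<bar> \<le> \<bar>c - d\<bar>" for x
        using logistic_lipschitz[of "c + ?r x" "d + ?r x"] by simp
    qed simp
    finally show ?thesis .
  qed
  have "\<exists>c. \<kappa> - 1 / \<epsilon> \<le> c \<and> c \<le> \<kappa> + 1 / \<epsilon> \<and> ?g c = ?\<theta>"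
  proof (rule IVT')
    show "?g (\<kappa> - 1 / \<epsilon>) \<le> ?\<theta>"
    proof -
      have "?g (\<kappa> - 1 / \<epsilon>) \<le> (LINT x|unit_lborel. logistic \<kappa>)"
        using rb by (intro integral_mono int) (auto intro!: logistic_mono simp: abs_le_iff)
      then show ?thesis by (simp only: LINT_unit_lborel_const \<kappa>)
    qed
    show "?\<theta> \<le> ?g (\<kappa> + 1 / \<epsilon>)"
    proof -
      have "(LINT x|unit_lborel. logistic \<kappa>) \<le> ?g (\<kappa> + 1 / \<epsilon>)"
      proof (intro integral_mono int)
        fix x assume "x \<in> space unit_lborel"
        then show "logistic \<kappa> \<le> logistic (\<kappa> + 1 / \<epsilon> + ?r x)"
          using rb[of x] by (intro logistic_mono) (auto simp: abs_le_iff)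
      qed simp
      then show ?thesis by (simp only: LINT_unit_lborel_const \<kappa>)
    qed
    show "continuous_on {\<kappa> - 1 / \<epsilon>..\<kappa> + 1 / \<epsilon>} ?g"
      by (rule lipschitz_on_continuous_on[of 1], rule lipschitz_onI) (use lip in \<open>auto simp: dist_real_def\<close>)
  qed (use eps_pos in auto)
  then obtain c where c: "?g c = ?\<theta>" by blast
  have pc: "primitive c (drift \<rho> p) x = c + ?r x" for x
    by (simp add: primitive_def)
  have "(\<lambda>x. logistic (primitive c (drift \<rho> p) x) / \<epsilon>) \<in> lip_densities"
    unfolding lip_densities_def mem_Collect_eq
  proof (intro conjI ballI)
    fix x y :: real assume xy: "x \<in> {0..1}" "y \<in> {0..1}"
    have "\<bar>logistic (primitive c (drift \<rho> p) x) - logistic (primitive c (drift \<rho> p) y)\<bar> \<le> 1 / \<epsilon> * \<bar>x - y\<bar>"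
      by (rule order_trans[OF logistic_lipschitz primitive_abs_diff_le[OF k xy]])
    then have "\<bar>logistic (primitive c (drift \<rho> p) x) - logistic (primitive c (drift \<rho> p) y)\<bar> / \<epsilon> \<le> 1 / \<epsilon> * \<bar>x - y\<bar> / \<epsilon>"
      using eps_pos by (intro divide_right_mono) auto
    then show "\<bar>logistic (primitive c (drift \<rho> p) x) / \<epsilon> - logistic (primitive c (drift \<rho> p) y) / \<epsilon>\<bar> \<le> \<bar>x - y\<bar> / \<epsilon>\<^sup>2"
      using eps_pos by (simp add: diff_divide_distrib[symmetric] abs_divide power2_eq_square)
  next
    fix x show "0 \<le> logistic (primitive c (drift \<rho> p) x) / \<epsilon>" "logistic (primitive c (drift \<rho> p) x) / \<epsilon> \<le> 1 / \<epsilon>"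
      using logistic_bounds[of "primitive c (drift \<rho> p) x"] eps_pos by (auto intro!: divide_right_mono)
  next
    show "(LINT x|unit_lborel. logistic (primitive c (drift \<rho> p) x) / \<epsilon>) = \<phi>1 - \<phi>0"
      unfolding pc using c eps_pos by simp
  qed
  then show ?thesis by (rule that)
qed

text \<open>The profile \<open>w\<close> minimizes the functional obtained from \<open>G \<rho>\<close> by replacing the concave term
  \<open>- ln (1 + exp \<phi>)\<close> with its tangent line at \<open>primitive \<phi>0 p\<close>, which lies above it.\<close>

lemma descent:
  assumes \<rho>: "\<rho> \<in> profiles" and p: "p \<in> densities"
    and w_def: "w = (\<lambda>x. logistic (primitive c (drift \<rho> p) x) / \<epsilon>)" and w: "w \<in> lip_densities"
  shows "G \<rho> w + (LINT x|unit_lborel. bregman (\<epsilon> * p x) (\<epsilon> * w x)) \<le> G \<rho> p"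
proof -
  have wd: "w \<in> densities" using w lip_densities_subset_densities by auto
  let ?u = "primitive c (drift \<rho> p)" and ?\<phi> = "primitive \<phi>0 p" and ?\<psi> = "primitive \<phi>0 w"
  let ?k = "drift \<rho> p" and ?q = "\<lambda>x. p x - w x"
  note k = drift_measurable[OF \<rho> p] drift_abs_le[OF \<rho> p]
  have uc: "continuous_on {0..1} ?u" "continuous_on {0..1} (primitive 0 ?k)"
    by (rule continuous_on_primitive[OF k])+
  have kint: "integrable unit_lborel ?k"
    by (rule bounded_unit_integrable[OF k])
  note [measurable] = profiles_measurable[OF \<rho>] densities_measurable[OF p] densities_measurable[OF wd] k(1)
    continuous_unit_measurable[OF primitive_continuous[OF p]]
    continuous_unit_measurable[OF primitive_continuous[OF wd]]
    continuous_unit_measurable[OF uc(1)]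
  have qint: "integrable unit_lborel ?q"
    by (intro Bochner_Integration.integrable_diff densities_integrable p wd)
  have \<phi>\<psi>: "?\<phi> x - ?\<psi> x = primitive 0 ?q x" for x
    by (simp add: primitive_diff densities_integrable p wd)
  have qb: "AE x in unit_lborel. \<bar>?q x\<bar> \<le> 1 / \<epsilon>"
    using densities_range[OF p] densities_range[OF wd] by eventually_elim auto
  have Qc: "continuous_on {0..1} (primitive 0 ?q)"
    by (rule continuous_on_primitive[OF _ qb]) measurable
  have int1: "integrable unit_lborel (\<lambda>x. ?q x * ?u x)" "integrable unit_lborel (\<lambda>x. ?q x * primitive 0 ?k x)"
    by (rule bounded_mult_integrable[OF _ qb continuous_unit_integrable[OF uc(1)]], measurable)
      (rule bounded_mult_integrable[OF _ qb continuous_unit_integrable[OF uc(2)]], measurable)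
  have int2: "integrable unit_lborel (\<lambda>x. ?k x * primitive 0 ?q x)"
    by (rule bounded_mult_integrable[OF k continuous_unit_integrable[OF Qc]])
  have brint: "integrable unit_lborel (\<lambda>x. bregman (\<epsilon> * p x) (\<epsilon> * w x))"
  proof -
    \<comment> \<open>\<open>\<epsilon> * w x\<close> is \<open>logistic (?u x)\<close>, so its
      logit is \<open>?u x\<close>.\<close>
    have "bregman (\<epsilon> * p x) (\<epsilon> * w x) = entropy_s (\<epsilon> * p x) - entropy_s (\<epsilon> * w x) - \<epsilon> * (?q x * ?u x)" for x
      unfolding bregman_def w_def using eps_pos by (simp add: logit_logistic algebra_simps)
    then show ?thesis
      using integrable_entropy_s_density[OF p] integrable_entropy_s_density[OF wd] int1 by auto
  qed
  have Gint: "integrable unit_lborel (\<lambda>x. entropy_s (\<rho> x) + entropy_s (\<epsilon> * p x)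
     + (1 - \<rho> x) * primitive \<phi>0 p x - ln (1 + exp (primitive \<phi>0 p x)))" if p: "p \<in> densities" for p
  proof -
    have "AE x in unit_lborel. \<bar>\<rho> x\<bar> \<le> 1"
      using profiles_range[OF \<rho>] by eventually_elim auto
    then have "integrable unit_lborel (\<lambda>x. \<rho> x * primitive \<phi>0 p x)"
      by (intro bounded_mult_integrable profiles_measurable \<rho> continuous_unit_integrable primitive_continuous p)
    moreover have "integrable unit_lborel (\<lambda>x. entropy_s (\<rho> x))"
      using integrable_entropy_s profiles_measurable[OF \<rho>] profiles_range[OF \<rho>] by auto
    ultimately have "integrable unit_lborel (\<lambda>x. entropy_s (\<rho> x) + (entropy_s (\<epsilon> * p x) + primitive \<phi>0 p x
        - ln (1 + exp (primitive \<phi>0 p x))) - \<rho> x * primitive \<phi>0 p x)"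
      using C_integrable[OF p] by auto
    then show ?thesis
      by (rule back_subst[of "integrable unit_lborel"]) (auto simp: algebra_simps)
  qed
  have "(LINT x|unit_lborel. \<epsilon> * (?q x * ?u x + ?k x * primitive 0 ?q x)
      + bregman (\<epsilon> * p x) (\<epsilon> * w x)) \<le> G \<rho> p - G \<rho> w"
  proof -
    have "(LINT x|unit_lborel. \<epsilon> * (?q x * ?u x + ?k x * primitive 0 ?q x)
      + bregman (\<epsilon> * p x) (\<epsilon> * w x)) \<le>
     (LINT x|unit_lborel. (entropy_s (\<rho> x) + entropy_s (\<epsilon> * p x) + (1 - \<rho> x) * ?\<phi> x - ln (1 + exp (?\<phi> x)))
        - (entropy_s (\<rho> x) + entropy_s (\<epsilon> * w x) + (1 - \<rho> x) * ?\<psi> x - ln (1 + exp (?\<psi> x))))"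
    proof (rule integral_mono[OF _ Bochner_Integration.integrable_diff[OF Gint[OF p] Gint[OF wd]]])
      fix x
      have 1: "bregman (\<epsilon> * p x) (\<epsilon> * w x) = entropy_s (\<epsilon> * p x) - entropy_s (\<epsilon> * w x) - \<epsilon> * (?q x * ?u x)"
        unfolding bregman_def w_def using eps_pos by (simp add: logit_logistic algebra_simps)
      \<comment> \<open>\<open>\<epsilon> * ?k x\<close> is the slope at \<open>?\<phi> x\<close> of
        the part of the integrand that depends on \<phi> itself.\<close>
      have 2: "\<epsilon> * (?k x * primitive 0 ?q x) = (1 - logistic (?\<phi> x) - \<rho> x) * (?\<phi> x - ?\<psi> x)"
        unfolding drift_def \<phi>\<psi>[symmetric] using eps_pos by simp
      show "\<epsilon> * (?q x * ?u x + ?k x * primitive 0 ?q x) + bregman (\<epsilon> * p x) (\<epsilon> * w x) \<le>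
        (entropy_s (\<rho> x) + entropy_s (\<epsilon> * p x) + (1 - \<rho> x) * ?\<phi> x - ln (1 + exp (?\<phi> x)))
        - (entropy_s (\<rho> x) + entropy_s (\<epsilon> * w x) + (1 - \<rho> x) * ?\<psi> x - ln (1 + exp (?\<psi> x)))"
        unfolding distrib_left[of \<epsilon>] 1 2 using ln_1_plus_exp_above_tangent[of "?\<phi> x" "?\<psi> x"]
        by (simp add: algebra_simps)
    qed (use int1 int2 brint in auto)
    also have "\<dots> = G \<rho> p - G \<rho> w"
      unfolding G_def using Gint[OF p] Gint[OF wd] by (rule Bochner_Integration.integral_diff)
    finally show ?thesis .
  qed
  \<comment> \<open>Stationarity of \<open>w\<close> for the convexified problem: \<open>?u\<close>
    is \<open>c\<close> plus the primitive of \<open>?k\<close>. The constant drops out since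
    \<open>p\<close> and \<open>w\<close> have the same mass, and the rest cancels by
    \<open>LINT_mult_primitive\<close>.\<close>
  moreover have "(LINT x|unit_lborel. ?q x * ?u x + ?k x * primitive 0 ?q x) = 0"
  proof -
    have q0: "(LINT x|unit_lborel. ?q x) = 0"
      using densities_integrable[OF p] densities_integrable[OF wd] densities_LINT[OF p] densities_LINT[OF wd] by simp
    have "(LINT x|unit_lborel. ?q x * primitive 0 ?k x) = (LINT x|unit_lborel. ?k x * (0 - primitive 0 ?q x))"
      using LINT_mult_primitive[OF k(1) _ kint qint] qint unfolding q0 by auto
    moreover have "?q x * ?u x = c * ?q x + ?q x * primitive 0 ?k x" for x
      by (simp add: primitive_def algebra_simps)
    ultimately show ?thesis
      using int1 int2 qint q0 by simp
  qed
  ultimately show ?thesis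
    using int1 int2 brint by simp
qed

section \<open>Compactness, existence of minimizers and the Euler-Lagrange equation\<close>

lemma lip_densities_in_densities: "w \<in> lip_densities \<Longrightarrow> w \<in> densities"
  using lip_densities_subset_densities by auto

lemma lip_densities_nonempty: "(\<lambda>_. \<phi>1 - \<phi>0) \<in> lip_densities"
proof -
  have "(LINT x|unit_lborel. \<phi>1 - \<phi>0) = \<phi>1 - \<phi>0"
    by (rule LINT_unit_lborel_const)
  then show ?thesis
    unfolding lip_densities_def mem_Collect_eq using eps_pos phi_less eps_small by (auto simp: field_simps)
qed

text \<open>Arzela-Ascoli with the common Lipschitz constant. The pointwise constraints survive the
  limit, and the mass does so by dominated convergence.\<close>

lemma lip_densities_seq_compact:
  assumes f: "\<And>n. f n \<in> lip_densities"
  obtains w r where "w \<in> lip_densities" "strict_mono (r :: nat \<Rightarrow> nat)" "uniform_limit {0..1} (\<lambda>n. f (r n)) w sequentially"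
proof -
  obtain w r where r: "strict_mono (r :: nat \<Rightarrow> nat)"
    and lim: "\<And>e. 0 < e \<Longrightarrow> \<exists>N. \<forall>n x. n \<ge> N \<and> x \<in> {0..1} \<longrightarrow> norm (f (r n) x - w x) < e"
  proof (rule Arzela_Ascoli[of "{0..1::real}" f "1 / \<epsilon>"])
    show "norm (f n x) \<le> 1 / \<epsilon>" if "x \<in> {0..1}" for n x
      using lip_densities_range[OF f that] by simp
    show "\<exists>d. 0 < d \<and> (\<forall>n y. y \<in> {0..1} \<and> norm (x - y) < d \<longrightarrow> norm (f n x - f n y) < e)"
      if "x \<in> {0..1}" "0 < e" for x e
    proof (intro exI[of _ "e * \<epsilon>\<^sup>2"] conjI allI impI)
      fix n y assume y: "y \<in> {0..1} \<and> norm (x - y) < e * \<epsilon>\<^sup>2"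
      have "\<bar>f n x - f n y\<bar> \<le> \<bar>x - y\<bar> / \<epsilon>\<^sup>2"
        using f[of n] y that by (auto simp: lip_densities_def)
      also have "\<dots> < e"
        using y eps_pos by (simp add: field_simps)
      finally show "norm (f n x - f n y) < e" by simp
    qed (use that eps_pos in simp)
  qed auto
  have ul: "uniform_limit {0..1} (\<lambda>n. f (r n)) w sequentially"
    unfolding uniform_limit_iff eventually_sequentially dist_norm using lim by blast
  have pw: "(\<lambda>n. f (r n) x) \<longlonglongrightarrow> w x" if "x \<in> {0..1}" for x
    using ul that by (rule tendsto_uniform_limitI)
  have "continuous_on {0..1} w"
    by (rule uniform_limit_theorem[OF _ ul]) (auto intro!: always_eventually lip_densities_continuous f)
  then have [measurable]: "w \<in> borel_measurable unit_lborel"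
    by (rule continuous_unit_measurable)
  have "w \<in> lip_densities"
    unfolding lip_densities_def mem_Collect_eq
  proof (intro conjI ballI)
    fix x y :: real assume xy: "x \<in> {0..1}" "y \<in> {0..1}"
    have "(\<lambda>n. \<bar>f (r n) x - f (r n) y\<bar>) \<longlonglongrightarrow> \<bar>w x - w y\<bar>"
      by (intro tendsto_intros pw xy)
    then show "\<bar>w x - w y\<bar> \<le> \<bar>x - y\<bar> / \<epsilon>\<^sup>2"
      by (rule LIMSEQ_le_const2) (use f xy in \<open>auto simp: lip_densities_def\<close>)
  next
    fix x :: real assume x: "x \<in> {0..1}"
    show "0 \<le> w x" "w x \<le> 1 / \<epsilon>"
      using LIMSEQ_le_const[OF pw[OF x]] LIMSEQ_le_const2[OF pw[OF x]] lip_densities_range[OF f x] by blast+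
  next
    have "(\<lambda>n. LINT x|unit_lborel. f (r n) x) \<longlonglongrightarrow> (LINT x|unit_lborel. w x)"
    proof (rule integral_dominated_convergence[where w = "\<lambda>_. 1 / \<epsilon>"])
      show "AE x in unit_lborel. norm (f (r n) x) \<le> 1 / \<epsilon>" for n
        using lip_densities_range[OF f] by (intro AE_unit_lborelI) auto
    qed (use pw in \<open>auto intro!: AE_unit_lborelI continuous_unit_measurable lip_densities_continuous f\<close>)
    then show "(LINT x|unit_lborel. w x) = \<phi>1 - \<phi>0"
      using f by (simp add: lip_densities_def LIMSEQ_const_iff)
  qed
  then show ?thesis using r ul by (rule that)
qed

text \<open>The functional is kept abstract because the result serves twice: for
  \<open>G \<rho>\<close> and for the penalty in \<open>closed_convex_separation\<close>.\<close>

lemma lip_densities_attains_min: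
  assumes F: "\<And>f w. (\<And>n. f n \<in> lip_densities) \<Longrightarrow> w \<in> lip_densities \<Longrightarrow> uniform_limit {0..1} f w sequentially \<Longrightarrow>
      (\<lambda>n. F (f n)) \<longlonglongrightarrow> (F w :: real)"
  shows "\<exists>w\<in>lip_densities. \<forall>w'\<in>lip_densities. F w \<le> F w'"
proof -
  have "seq_compact (F ` lip_densities)"
    unfolding seq_compact_def
  proof (intro allI impI)
    fix g :: "nat \<Rightarrow> real" assume "\<forall>n. g n \<in> F ` lip_densities"
    then have "\<forall>n. \<exists>w. w \<in> lip_densities \<and> g n = F w"
      by blast
    then obtain f where f: "\<And>n. f n \<in> lip_densities" "\<And>n. g n = F (f n)"
      by metis
    obtain w r where w: "w \<in> lip_densities" "strict_mono (r :: nat \<Rightarrow> nat)" "uniform_limit {0..1} (\<lambda>n. f (r n)) w sequentially"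
      using lip_densities_seq_compact[OF f(1)] .
    then have "(\<lambda>n. F (f (r n))) \<longlonglongrightarrow> F w"
      using f(1) by (intro F)
    then show "\<exists>l\<in>F ` lip_densities. \<exists>r. strict_mono r \<and> (g \<circ> r) \<longlonglongrightarrow> l"
      using w by (auto simp: f(2) comp_def intro!: exI[of _ r])
  qed
  then have "compact (F ` lip_densities)"
    by (simp add: compact_eq_seq_compact_metric)
  then show ?thesis
    using compact_attains_inf[of "F ` lip_densities"] lip_densities_nonempty by auto
qed

lemma primitive_lip_densities_abs_le:
  assumes w: "w \<in> lip_densities" and x: "x \<in> {0..1}"
  shows "\<bar>primitive c w x\<bar> \<le> \<bar>c\<bar> + 1 / \<epsilon>"
proof -
  have "\<bar>primitive c w x - primitive c w 0\<bar> \<le> 1 / \<epsilon> * \<bar>x - 0\<bar>"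
    by (rule primitive_abs_diff_le) (use w x densities_measurable densities_abs_le lip_densities_in_densities in auto)
  also have "\<dots> \<le> 1 / \<epsilon>"
    using x eps_pos by (simp add: divide_le_cancel)
  finally show ?thesis by (simp add: primitive_0)
qed

lemma primitive_tendsto:
  assumes f: "\<And>n. f n \<in> lip_densities" and w: "w \<in> lip_densities" and ul: "uniform_limit {0..1} f w sequentially"
  shows "(\<lambda>n. primitive c (f n) x) \<longlonglongrightarrow> primitive c w x"
proof (rule LIMSEQ_I)
  fix e :: real assume e: "0 < e"
  then obtain N where N: "\<And>n y. n \<ge> N \<Longrightarrow> y \<in> {0..1} \<Longrightarrow> dist (f n y) (w y) < e / 2"
    using ul unfolding uniform_limit_iff eventually_sequentially by (meson half_gt_zero)
  show "\<exists>N. \<forall>n\<ge>N. norm (primitive c (f n) x - primitive c w x) < e"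
  proof (intro exI allI impI)
    fix n assume "n \<ge> N"
    then have "\<bar>primitive c (f n) x - primitive c w x\<bar> \<le> e / 2"
      using N by (intro primitive_dist_le densities_integrable lip_densities_in_densities f w) (auto simp: dist_real_def less_imp_le)
    then show "norm (primitive c (f n) x - primitive c w x) < e"
      using e by simp
  qed
qed

lemma pairing_primitive_tendsto:
  assumes v: "integrable unit_lborel v"
    and f: "\<And>n. f n \<in> lip_densities" and w: "w \<in> lip_densities" and ul: "uniform_limit {0..1} f w sequentially"
  shows "(\<lambda>n. pairing v (primitive c (f n))) \<longlonglongrightarrow> pairing v (primitive c w)"
  unfolding pairing_def
proof (rule integral_dominated_convergence[where w = "\<lambda>x. \<bar>v x\<bar> * (\<bar>c\<bar> + 1 / \<epsilon>)"])
  have [measurable]: "v \<in> borel_measurable unit_lborel"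
    using v by auto
  have [measurable]: "primitive c (f n) \<in> borel_measurable unit_lborel" "primitive c w \<in> borel_measurable unit_lborel" for n
    by (intro continuous_unit_measurable primitive_continuous lip_densities_in_densities f w)+
  show "(\<lambda>x. v x * primitive c w x) \<in> borel_measurable unit_lborel"
    "(\<lambda>x. v x * primitive c (f n) x) \<in> borel_measurable unit_lborel" for n
    by measurable
  show "AE x in unit_lborel. norm (v x * primitive c (f n) x) \<le> \<bar>v x\<bar> * (\<bar>c\<bar> + 1 / \<epsilon>)" for n
    using primitive_lip_densities_abs_le[OF f] by (intro AE_unit_lborelI) (simp add: abs_mult mult_left_mono)
  show "AE x in unit_lborel. (\<lambda>n. v x * primitive c (f n) x) \<longlonglongrightarrow> v x * primitive c w x"
    by (intro AE_I2 tendsto_intros primitive_tendsto f w ul)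
qed (use v in auto)

lemma C_tendsto:
  assumes f: "\<And>n. f n \<in> lip_densities" and w: "w \<in> lip_densities" and ul: "uniform_limit {0..1} f w sequentially"
  shows "(\<lambda>n. C (f n)) \<longlonglongrightarrow> C w"
proof -
  obtain B where B: "\<forall>a\<in>{0..1}. \<bar>entropy_s a\<bar> \<le> B"
    using entropy_s_bounded by blast
  let ?R = "\<bar>\<phi>0\<bar> + 1 / \<epsilon>"
  have range: "\<epsilon> * v x \<in> {0..1}" if "v \<in> lip_densities" "x \<in> {0..1}" for v x
    using lip_densities_range[OF that] eps_pos by (auto simp: field_simps)
  note pos = add_pos_pos[OF zero_less_one exp_gt_zero]
  show ?thesis
    unfolding C_def
  proof (rule integral_dominated_convergence[where w = "\<lambda>x. B + ?R + ln (1 + exp ?R)"])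
    show "AE x in unit_lborel. norm (entropy_s (\<epsilon> * f n x) + primitive \<phi>0 (f n) x - ln (1 + exp (primitive \<phi>0 (f n) x)))
        \<le> B + ?R + ln (1 + exp ?R)" for n
    proof (rule AE_unit_lborelI)
      fix x :: real assume x: "x \<in> {0..1}"
      have 1: "\<bar>primitive \<phi>0 (f n) x\<bar> \<le> ?R"
        by (rule primitive_lip_densities_abs_le[OF f x])
      have 2: "\<bar>entropy_s (\<epsilon> * f n x)\<bar> \<le> B"
        using B range[OF f x] by blast
      have 3: "0 \<le> ln (1 + exp (primitive \<phi>0 (f n) x))" "ln (1 + exp (primitive \<phi>0 (f n) x)) \<le> ln (1 + exp ?R)"
        using 1 pos by (auto simp: ln_ge_zero)
      show "norm (entropy_s (\<epsilon> * f n x) + primitive \<phi>0 (f n) x - ln (1 + exp (primitive \<phi>0 (f n) x)))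
        \<le> B + ?R + ln (1 + exp ?R)"
        using 1 2 3 unfolding real_norm_def abs_le_iff by linarith
    qed
    show "AE x in unit_lborel. (\<lambda>n. entropy_s (\<epsilon> * f n x) + primitive \<phi>0 (f n) x - ln (1 + exp (primitive \<phi>0 (f n) x)))
       \<longlonglongrightarrow> entropy_s (\<epsilon> * w x) + primitive \<phi>0 w x - ln (1 + exp (primitive \<phi>0 w x))"
    proof (rule AE_unit_lborelI)
      fix x :: real assume x: "x \<in> {0..1}"
      have "(\<lambda>n. \<epsilon> * f n x) \<longlonglongrightarrow> \<epsilon> * w x"
        by (intro tendsto_intros tendsto_uniform_limitI[OF ul x])
      then have "(\<lambda>n. entropy_s (\<epsilon> * f n x)) \<longlonglongrightarrow> entropy_s (\<epsilon> * w x)"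
        by (rule continuous_on_tendsto_compose[OF continuous_on_entropy_s])
          (use range[OF _ x] f w in auto)
      then show "(\<lambda>n. entropy_s (\<epsilon> * f n x) + primitive \<phi>0 (f n) x - ln (1 + exp (primitive \<phi>0 (f n) x)))
       \<longlonglongrightarrow> entropy_s (\<epsilon> * w x) + primitive \<phi>0 w x - ln (1 + exp (primitive \<phi>0 w x))"
        using less_imp_neq[OF pos, symmetric] by (intro tendsto_intros primitive_tendsto f w ul) auto
    qed
  qed (use C_integrable[OF lip_densities_in_densities[OF w]] C_integrable[OF lip_densities_in_densities[OF f]] in auto)
qed

text \<open>Minimality is asked only within \<open>lip_densities\<close>, where compactness is
  available; \<open>minimizer_le_densities\<close> extends it to all of
  \<open>densities\<close>.\<close>

definition minimizer :: "(real \<Rightarrow> real) \<Rightarrow> (real \<Rightarrow> real) \<Rightarrow> bool" where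
  "minimizer \<rho> w \<longleftrightarrow> w \<in> lip_densities \<and> (\<forall>w'\<in>lip_densities. G \<rho> w \<le> G \<rho> w')"

lemma minimizer_exists:
  assumes \<rho>: "\<rho> \<in> profiles"
  shows "\<exists>w. minimizer \<rho> w"
proof -
  have "\<exists>w\<in>lip_densities. \<forall>w'\<in>lip_densities. G \<rho> w \<le> G \<rho> w'"
  proof (rule lip_densities_attains_min)
    fix f w assume f: "\<And>n. f n \<in> lip_densities" and w: "w \<in> lip_densities" and ul: "uniform_limit {0..1} f w sequentially"
    show "(\<lambda>n. G \<rho> (f n)) \<longlonglongrightarrow> G \<rho> w"
      unfolding G_eq[OF \<rho> lip_densities_in_densities[OF f]] G_eq[OF \<rho> lip_densities_in_densities[OF w]]
      by (intro tendsto_intros C_tendsto pairing_primitive_tendsto profiles_integrable \<rho> f w ul)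
  qed
  then show ?thesis by (auto simp: minimizer_def)
qed

text \<open>One descent step moves \<open>p\<close> into \<open>lip_densities\<close> without
  raising \<open>G \<rho>\<close>.\<close>

lemma minimizer_le_densities:
  assumes \<rho>: "\<rho> \<in> profiles" and m: "minimizer \<rho> w" and p: "p \<in> densities"
  shows "G \<rho> w \<le> G \<rho> p"
proof -
  obtain c where v: "(\<lambda>x. logistic (primitive c (drift \<rho> p) x) / \<epsilon>) \<in> lip_densities" (is "?v \<in> lip_densities")
    using logistic_primitive_in_lip_densities[OF \<rho> p] .
  have "AE x in unit_lborel. 0 \<le> bregman (\<epsilon> * p x) (\<epsilon> * ?v x)"
    using densities_range[OF p]
    by eventually_elim (use logistic_bounds eps_pos in \<open>auto intro!: bregman_nonneg simp: field_simps\<close>)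
  then have "0 \<le> (LINT x|unit_lborel. bregman (\<epsilon> * p x) (\<epsilon> * ?v x))"
    by (rule integral_nonneg_AE)
  then have "G \<rho> ?v \<le> G \<rho> p"
    using descent[OF \<rho> p refl v] by simp
  then show ?thesis
    using m v unfolding minimizer_def by force
qed

lemma quasi_potential_eq:
  assumes \<rho>: "\<rho> \<in> profiles" and m: "minimizer \<rho> w"
  shows "quasi_potential \<epsilon> \<phi>0 \<phi>1 \<rho> = ereal (G \<rho> w)"
proof -
  have "(INF \<phi>\<in>phi_space \<phi>0 \<phi>1. trial_G \<epsilon> \<phi>0 \<rho> \<phi>) = ereal (G \<rho> w)"
  proof (rule antisym)
    have w: "w \<in> densities"
      using m by (auto simp: minimizer_def lip_densities_in_densities)
    show "(INF \<phi>\<in>phi_space \<phi>0 \<phi>1. trial_G \<epsilon> \<phi>0 \<rho> \<phi>) \<le> ereal (G \<rho> w)"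
      using primitive_trial_G[OF w profiles_measurable[OF \<rho>]] by (metis INF_lower)
    show "ereal (G \<rho> w) \<le> (INF \<phi>\<in>phi_space \<phi>0 \<phi>1. trial_G \<epsilon> \<phi>0 \<rho> \<phi>)"
    proof (rule INF_greatest)
      fix \<phi> assume "\<phi> \<in> phi_space \<phi>0 \<phi>1"
      from trial_G_cases[OF this, of \<rho>] show "ereal (G \<rho> w) \<le> trial_G \<epsilon> \<phi>0 \<rho> \<phi>"
        using minimizer_le_densities[OF \<rho> m] by auto
    qed
  qed
  then show ?thesis
    using \<rho> by (simp add: quasi_potential_def)
qed

text \<open>A descent step from a minimizer gains nothing, so the divergence in
  \<open>descent\<close> vanishes and \<open>w\<close> is a fixed point of the step. No variation of
  \<open>G\<close> is taken, hence neither the constraint on the range of \<open>w\<close> nor the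
  infinite slope of s at 0 and 1 interferes.\<close>

lemma minimizer_euler_lagrange:
  assumes \<rho>: "\<rho> \<in> profiles" and m: "minimizer \<rho> w"
  obtains c where "\<And>x. x \<in> {0..1} \<Longrightarrow> w x = logistic (primitive c (drift \<rho> w) x) / \<epsilon>"
proof -
  have w: "w \<in> lip_densities" "w \<in> densities"
    using m by (auto simp: minimizer_def lip_densities_in_densities)
  obtain c where v: "(\<lambda>x. logistic (primitive c (drift \<rho> w) x) / \<epsilon>) \<in> lip_densities" (is "?v \<in> lip_densities")
    using logistic_primitive_in_lip_densities[OF \<rho> w(2)] .
  have eps_v: "\<epsilon> * ?v x = logistic (primitive c (drift \<rho> w) x)" for x
    using eps_pos by simp
  have range: "\<epsilon> * w x \<in> {0..1}" if "x \<in> {0..1}" for x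
    using lip_densities_range[OF w(1) that] eps_pos by (auto simp: field_simps)
  have "G \<rho> w \<le> G \<rho> ?v"
    using m v by (auto simp: minimizer_def)
  then have le: "(LINT x|unit_lborel. bregman (\<epsilon> * w x) (\<epsilon> * ?v x)) \<le> 0"
    using descent[OF \<rho> w(2) refl v] by simp
  have cont: "continuous_on {0..1} (\<lambda>x. bregman (\<epsilon> * w x) (\<epsilon> * ?v x))"
    unfolding eps_v
  proof (rule continuous_on_bregman_logistic)
    show "continuous_on {0..1} (\<lambda>x. \<epsilon> * w x)"
      by (intro continuous_intros lip_densities_continuous w)
    show "continuous_on {0..1} (primitive c (drift \<rho> w))"
      by (rule continuous_on_primitive[OF drift_measurable[OF \<rho> w(2)] drift_abs_le[OF \<rho> w(2)]])
  qed (use range in auto)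
  have "w x = ?v x" if x: "x \<in> {0..1}" for x
  proof -
    have "bregman (\<epsilon> * w x) (\<epsilon> * ?v x) = 0"
      by (rule continuous_eq_0_of_LINT_unit[OF cont _ le x])
        (unfold eps_v, use range logistic_bounds in \<open>auto intro!: bregman_nonneg\<close>)
    then have "\<epsilon> * w x = \<epsilon> * ?v x"
      by (intro bregman_eq_0[OF range[OF x]]) (unfold eps_v, use logistic_bounds in auto)
    then show ?thesis using eps_pos by (simp add: field_simps)
  qed
  then show ?thesis by (rule that)
qed

end

section \<open>Semidifferentials at a smooth profile\<close>

locale smooth_profile = quasi_potential_data +
  fixes \<rho> \<rho>' :: "real \<Rightarrow> real"
  assumes rho_deriv: "\<And>x. x \<in> {0..1} \<Longrightarrow> (\<rho> has_real_derivative \<rho>' x) (at x within {0..1})"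
    and rho'_cont: "continuous_on {0..1} \<rho>'"
    and rho_range: "\<And>x. x \<in> {0..1} \<Longrightarrow> 0 < \<rho> x" "\<And>x. x \<in> {0..1} \<Longrightarrow> \<rho> x < 1"
    and phi0_eq: "ln (\<rho> 0) - ln (1 - \<rho> 0) = \<phi>0" and phi1_eq: "ln (\<rho> 1) - ln (1 - \<rho> 1) = \<phi>1"
begin

lemma rho_cont: "continuous_on {0..1} \<rho>"
  using DERIV_continuous[OF rho_deriv] by (simp add: continuous_on_eq_continuous_within)

lemma rho_profile: "\<rho> \<in> profiles"
proof -
  have "AE x in unit_lborel. 0 \<le> \<rho> x \<and> \<rho> x \<le> 1"
    using rho_range by (intro AE_unit_lborelI) (simp add: less_imp_le)
  then show ?thesis
    unfolding profiles_def using continuous_in_Linf[OF rho_cont] by simp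
qed

text \<open>\<open>\<kappa> = s'(\<rho>)\<close>\<close>

definition \<kappa> :: "real \<Rightarrow> real" where
  "\<kappa> x = ln (\<rho> x) - ln (1 - \<rho> x)"

lemma kappa_deriv:
  assumes "x \<in> {0..1}"
  shows "(\<kappa> has_real_derivative \<rho>' x / mobility (\<rho> x)) (at x within {0..1})"
  unfolding \<kappa>_def[abs_def] mobility_def using rho_range[OF assms]
  by (auto intro!: derivative_eq_intros rho_deriv assms simp: field_simps)

lemma kappa_cont: "continuous_on {0..1} \<kappa>"
  using DERIV_continuous[OF kappa_deriv] by (simp add: continuous_on_eq_continuous_within)

definition Q :: "(real \<Rightarrow> real) \<Rightarrow> real" where
  "Q w = (LINT x|unit_lborel. (\<rho>' x - mobility (\<rho> x) * w x) * (1 - \<epsilon> * w x))"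

lemma primitive_lip_densities_1: "w \<in> lip_densities \<Longrightarrow> primitive \<phi>0 w 1 = \<phi>1"
  by (simp add: primitive_1 lip_densities_def)

text \<open>Since f = \<sigma> and
  \<open>\<sigma>(\<rho>) \<kappa>\<^sub>x = \<rho>\<^sub>x\<close>, the integrand of the
  Hamiltonian is \<open>\<sigma>(\<rho>) h\<^sub>x (1 + \<epsilon> (h\<^sub>x -
  \<kappa>\<^sub>x))\<close>, and \<open>h\<^sub>x - \<kappa>\<^sub>x = - w\<close>. The boundary
  values vanish because \<open>\<kappa>\<close> and the primitive of \<open>w\<close> both run from
  \<phi>0 to \<phi>1.\<close>

lemma Hamiltonian_eq_Q:
  assumes w: "w \<in> lip_densities" and h[measurable]: "h \<in> borel_measurable unit_lborel"
    and hw: "AE x in unit_lborel. h x = \<kappa> x - primitive \<phi>0 w x"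
  shows "h \<in> H10" and "Hamiltonian \<epsilon> \<rho> h = Q w"
proof -
  let ?g = "\<lambda>x. \<rho>' x / mobility (\<rho> x) - w x"
  have mob: "mobility (\<rho> x) \<noteq> 0" if "x \<in> {0..1}" for x
    using rho_range[OF that] by (simp add: mobility_def)
  have deriv: "((\<lambda>x. \<kappa> x - primitive \<phi>0 w x) has_real_derivative ?g x) (at x within {0..1})" if "x \<in> {0..1}" for x
    by (intro derivative_intros kappa_deriv primitive_has_derivative lip_densities_continuous w that)
  have mc: "continuous_on {0..1} (\<lambda>x. mobility (\<rho> x))"
    unfolding mobility_def by (intro continuous_intros rho_cont)
  have g: "continuous_on {0..1} ?g"
    using mob by (intro continuous_intros rho'_cont mc lip_densities_continuous w) auto
  have bd: "\<kappa> 0 - primitive \<phi>0 w 0 = 0" "\<kappa> 1 - primitive \<phi>0 w 1 = 0"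
    using phi0_eq phi1_eq primitive_lip_densities_1[OF w] by (simp_all add: \<kappa>_def primitive_0)
  show H10: "h \<in> H10"
    by (rule C1_in_H10[OF h hw deriv g bd])
  have wd: "AE x in unit_lborel. weak_deriv h x = ?g x"
    by (rule C1_weak_deriv[OF h hw deriv g bd])
  have [measurable]: "weak_deriv h \<in> borel_measurable unit_lborel"
    using H10_weak_deriv(1)[OF H10] by (auto simp: L2_def)
  have vd: "vector_derivative \<rho> (at x within {0..1}) = \<rho>' x" if "x \<in> {0..1}" for x
    using rho_deriv[OF that] that
    by (intro vector_derivative_within_closed_interval) (auto simp: has_real_derivative_iff_has_vector_derivative)
  note [measurable] = continuous_unit_measurable[OF mc] continuous_unit_measurable[OF rho'_cont]
    continuous_unit_measurable[OF lip_densities_continuous[OF w]]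
  have "pairing (weak_deriv h) (\<lambda>x. mobility (\<rho> x) * weak_deriv h x) =
      (LINT x|unit_lborel. ?g x * (mobility (\<rho> x) * ?g x))"
    unfolding pairing_def
  proof (rule integral_cong_AE)
    show "AE x in unit_lborel. weak_deriv h x * (mobility (\<rho> x) * weak_deriv h x) = ?g x * (mobility (\<rho> x) * ?g x)"
      using wd by eventually_elim simp
  qed measurable
  moreover have "pairing (\<lambda>x. \<epsilon> * vector_derivative \<rho> (at x within {0..1}) - flux (\<rho> x)) (weak_deriv h) =
      (LINT x|unit_lborel. (\<epsilon> * vector_derivative \<rho> (at x within {0..1}) - flux (\<rho> x)) * weak_deriv h x)"
    unfolding pairing_def ..
  moreover have "\<dots> = (LINT x|unit_lborel. (\<epsilon> * \<rho>' x - mobility (\<rho> x)) * weak_deriv h x)"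
    using vd by (intro Bochner_Integration.integral_cong) (auto simp: flux_def mobility_def)
  moreover have "\<dots> = (LINT x|unit_lborel. (\<epsilon> * \<rho>' x - mobility (\<rho> x)) * ?g x)"
  proof (rule integral_cong_AE)
    show "AE x in unit_lborel. (\<epsilon> * \<rho>' x - mobility (\<rho> x)) * weak_deriv h x = (\<epsilon> * \<rho>' x - mobility (\<rho> x)) * ?g x"
      using wd by eventually_elim simp
  qed measurable
  ultimately have "Hamiltonian \<epsilon> \<rho> h = \<epsilon> * (LINT x|unit_lborel. ?g x * (mobility (\<rho> x) * ?g x))
      - (LINT x|unit_lborel. (\<epsilon> * \<rho>' x - mobility (\<rho> x)) * ?g x)"
    unfolding Hamiltonian_def by simp
  also have "\<dots> = (LINT x|unit_lborel. \<epsilon> * (?g x * (mobility (\<rho> x) * ?g x)) - (\<epsilon> * \<rho>' x - mobility (\<rho> x)) * ?g x)"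
    by (subst Bochner_Integration.integral_diff)
      (auto intro!: continuous_unit_integrable continuous_on_mult continuous_on_diff g mc rho'_cont continuous_on_const)
  also have "\<dots> = Q w"
    unfolding Q_def
  proof (rule Bochner_Integration.integral_cong[OF refl])
    fix x assume "x \<in> space unit_lborel"
    then have *: "mobility (\<rho> x) * ?g x = \<rho>' x - mobility (\<rho> x) * w x"
      using mob[of x] by (simp add: right_diff_distrib)
    have "\<epsilon> * (?g x * (mobility (\<rho> x) * ?g x)) - (\<epsilon> * \<rho>' x - mobility (\<rho> x)) * ?g x
        = \<epsilon> * ?g x * (mobility (\<rho> x) * ?g x - \<rho>' x) + mobility (\<rho> x) * ?g x"
      by (simp only: ring_distribs mult.assoc mult.left_commute) simp
    also have "\<dots> = \<epsilon> * ?g x * (- mobility (\<rho> x) * w x) + mobility (\<rho> x) * ?g x"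
      unfolding * by simp
    also have "\<dots> = (mobility (\<rho> x) * ?g x) * (1 - \<epsilon> * w x)"
      by (simp only: ring_distribs) simp
    finally show "\<epsilon> * (?g x * (mobility (\<rho> x) * ?g x)) - (\<epsilon> * \<rho>' x - mobility (\<rho> x)) * ?g x =
        (\<rho>' x - mobility (\<rho> x) * w x) * (1 - \<epsilon> * w x)"
      unfolding * .
  qed
  finally show "Hamiltonian \<epsilon> \<rho> h = Q w" .
qed

lemma Q_minimizer:
  assumes m: "minimizer \<rho> w"
  shows "Q w = 0"
proof -
  have w: "w \<in> lip_densities" "w \<in> densities"
    using m by (auto simp: minimizer_def lip_densities_in_densities)
  obtain c where c: "\<And>x. x \<in> {0..1} \<Longrightarrow> w x = logistic (primitive c (drift \<rho> w) x) / \<epsilon>"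
    using minimizer_euler_lagrange[OF rho_profile m] by blast
  let ?U = "primitive c (drift \<rho> w)" and ?q = "\<lambda>x. 1 - logistic (primitive \<phi>0 w x)"
  \<comment> \<open>\<open>logistic (?U x)\<close> stands for \<open>\<epsilon> * w x\<close>: its
    derivative is explicit, whereas \<open>w\<close> is a priori only Lipschitz.\<close>
  let ?Z = "\<lambda>x. (\<rho> x + ?q x) * (1 - logistic (?U x)) + logistic (?U x)"
  have dc: "continuous_on {0..1} (drift \<rho> w)"
    unfolding drift_def[abs_def] using eps_pos
    by (intro continuous_intros rho_cont primitive_continuous w) auto
  have "Q w = ?Z 1 - ?Z 0"
    unfolding Q_def
  proof (rule LINT_unit_FTC)
    show "continuous_on {0..1} (\<lambda>x. (\<rho>' x - mobility (\<rho> x) * w x) * (1 - \<epsilon> * w x))"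
      unfolding mobility_def by (intro continuous_intros rho_cont rho'_cont lip_densities_continuous w)
  next
    fix x :: real assume x: "x \<in> {0..1}"
    let ?L = "logistic (?U x)"
    have eL: "?L = \<epsilon> * w x"
      using c[OF x] eps_pos by simp
    have L': "((\<lambda>x. logistic (?U x)) has_real_derivative ?L * (1 - ?L) * drift \<rho> w x) (at x within {0..1})"
      by (intro logistic_has_derivative primitive_has_derivative dc x)
    have q': "(?q has_real_derivative - ((1 - ?q x) * ?q x * w x)) (at x within {0..1})"
      by (rule derivative_eq_intros primitive_has_derivative lip_densities_continuous w x refl)+ simp
    have d: "\<epsilon> * drift \<rho> w x = ?q x - \<rho> x"
      using eps_pos by (simp add: drift_def)
    have "(?Z has_real_derivative (\<rho>' x - (1 - ?q x) * ?q x * w x) * (1 - ?L)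
        + (1 - (\<rho> x + ?q x)) * (?L * (1 - ?L) * drift \<rho> w x)) (at x within {0..1})"
      by (rule derivative_eq_intros rho_deriv x L' q' refl)+ (simp add: algebra_simps)
    also have "(\<rho>' x - (1 - ?q x) * ?q x * w x) * (1 - ?L) + (1 - (\<rho> x + ?q x)) * (?L * (1 - ?L) * drift \<rho> w x)
       = (\<rho>' x - (1 - ?q x) * ?q x * w x + (1 - (\<rho> x + ?q x)) * w x * (\<epsilon> * drift \<rho> w x)) * (1 - \<epsilon> * w x)"
      unfolding eL by (simp only: ring_distribs mult_ac)
    \<comment> \<open>By (1 - (\<rho> + q)) (q - \<rho>) = q (1 - q) - \<rho> (1 - \<rho>), the
      drift term exchanges the mobility of q for that of \<rho>.\<close>
    also have "\<rho>' x - (1 - ?q x) * ?q x * w x + (1 - (\<rho> x + ?q x)) * w x * (\<epsilon> * drift \<rho> w x) = \<rho>' x - mobility (\<rho> x) * w x"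
      unfolding d mobility_def by (simp only: ring_distribs mult_ac)
    finally show "(?Z has_real_derivative (\<rho>' x - mobility (\<rho> x) * w x) * (1 - \<epsilon> * w x)) (at x within {0..1})" .
  qed
  moreover have "?q 0 = 1 - \<rho> 0" "?q 1 = 1 - \<rho> 1"
    using logistic_logit[OF rho_range[of 0], unfolded phi0_eq] logistic_logit[OF rho_range[of 1], unfolded phi1_eq]
    by (simp_all add: primitive_0 primitive_lip_densities_1[OF w(1)])
  ultimately show ?thesis by simp
qed

section \<open>Directional derivatives of the quasi-potential\<close>

lemma rho_bounded_away: "\<exists>\<delta>>0. \<forall>x\<in>{0..1}. \<delta> \<le> \<rho> x \<and> \<rho> x \<le> 1 - \<delta>"
proof -
  have "compact ((\<lambda>x. min (\<rho> x) (1 - \<rho> x)) ` {0..1})"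
    by (intro compact_continuous_image continuous_intros rho_cont compact_Icc)
  then obtain y where y: "y \<in> {0..1}" "\<forall>x\<in>{0..1}. min (\<rho> y) (1 - \<rho> y) \<le> min (\<rho> x) (1 - \<rho> x)"
    using compact_attains_inf[of "(\<lambda>x. min (\<rho> x) (1 - \<rho> x)) ` {0..1}"] by auto
  then show ?thesis
    using rho_range[of y] by (intro exI[of _ "min (\<rho> y) (1 - \<rho> y)"]) force
qed

text \<open>Being bounded away from 0 and 1, \<open>\<rho>\<close> remains a profile under small
  perturbations in every direction of \<open>Linf\<close>, and the Taylor remainder of s is a
  Bregman divergence, quadratic in \<open>t\<close> by \<open>bregman_le\<close>.\<close>

lemma E_expansion:
  assumes v: "v \<in> Linf"
  obtains \<tau> K where "0 < \<tau>" "\<And>t. 0 < t \<Longrightarrow> t < \<tau> \<Longrightarrow> (\<lambda>x. \<rho> x + t * v x) \<in> profiles"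
    and "\<And>t. 0 < t \<Longrightarrow> t < \<tau> \<Longrightarrow> \<bar>E (\<lambda>x. \<rho> x + t * v x) - E \<rho> - t * pairing \<kappa> v\<bar> \<le> K * t\<^sup>2"
proof -
  obtain B0 where B0: "AE x in unit_lborel. \<bar>v x\<bar> \<le> B0" and [measurable]: "v \<in> borel_measurable unit_lborel"
    using v by (auto simp: Linf_def)
  \<comment> \<open>The maximum makes the bound positive, so that it can be divided by.\<close>
  define B where "B = max B0 1"
  have B: "AE x in unit_lborel. \<bar>v x\<bar> \<le> B" "0 < B"
    using B0 by (auto simp: B_def elim!: eventually_mono)
  obtain \<delta> where \<delta>: "0 < \<delta>" "\<And>x. x \<in> {0..1} \<Longrightarrow> \<delta> \<le> \<rho> x" "\<And>x. x \<in> {0..1} \<Longrightarrow> \<rho> x \<le> 1 - \<delta>"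
    using rho_bounded_away by blast
  \<comment> \<open>Half of the margin \<delta> is spent on the perturbation, the other half keeps
    both profiles in the range of \<open>bregman_le\<close>.\<close>
  let ?\<eta> = "\<delta> / 2"
  note [measurable] = continuous_unit_measurable[OF rho_cont] continuous_unit_measurable[OF kappa_cont]
  have close: "AE x in unit_lborel. \<rho> x \<in> {?\<eta>..1 - ?\<eta>} \<and> \<rho> x + t * v x \<in> {?\<eta>..1 - ?\<eta>} \<and> \<bar>t * v x\<bar> \<le> t * B"
    if t: "0 < t" "t < ?\<eta> / B" for t
  proof -
    have tB: "t * B \<le> ?\<eta>"
      using t B by (simp add: field_simps)
    have "AE x in unit_lborel. x \<in> {0..1}"
      by (rule AE_unit_lborelI)
    then show ?thesis
      using B(1)
    proof eventually_elim
      case (elim x)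
      then have 1: "\<bar>t * v x\<bar> \<le> t * B"
        using t by (simp add: abs_mult)
      then have "\<bar>t * v x\<bar> \<le> ?\<eta>" using tB by linarith
      then show ?case
        using \<delta>(2,3)[of x] \<delta>(1) elim(1) 1 unfolding abs_le_iff by auto
    qed
  qed
  have prof: "(\<lambda>x. \<rho> x + t * v x) \<in> profiles" if t: "0 < t" "t < ?\<eta> / B" for t
  proof -
    have "AE x in unit_lborel. 0 \<le> \<rho> x + t * v x \<and> \<rho> x + t * v x \<le> 1"
      using close[OF t] by eventually_elim (use \<delta>(1) in auto)
    moreover from this have "AE x in unit_lborel. \<bar>\<rho> x + t * v x\<bar> \<le> 1"
      by eventually_elim auto
    then have "(\<lambda>x. \<rho> x + t * v x) \<in> Linf"
      unfolding Linf_def by auto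
    ultimately show ?thesis by (simp add: profiles_def)
  qed
  have exp: "\<bar>E (\<lambda>x. \<rho> x + t * v x) - E \<rho> - t * pairing \<kappa> v\<bar> \<le> (2 / ?\<eta> * B\<^sup>2) * t\<^sup>2"
    if t: "0 < t" "t < ?\<eta> / B" for t
  proof -
    have kv: "integrable unit_lborel (\<lambda>x. \<kappa> x * v x)"
      using Linf_mult_integrable[OF v continuous_unit_integrable[OF kappa_cont]] by (simp add: mult.commute)
    have es: "integrable unit_lborel (\<lambda>x. entropy_s (f x))" if "f \<in> profiles" for f
      using integrable_entropy_s profiles_measurable[OF that] profiles_range[OF that] by auto
    have "E (\<lambda>x. \<rho> x + t * v x) - E \<rho> - t * pairing \<kappa> v =
        (LINT x|unit_lborel. entropy_s (\<rho> x + t * v x) - entropy_s (\<rho> x) - t * (\<kappa> x * v x))"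
      unfolding E_def pairing_def using es[OF prof[OF t]] es[OF rho_profile] kv by simp
    also have "\<dots> = (LINT x|unit_lborel. bregman (\<rho> x + t * v x) (\<rho> x))"
      by (intro Bochner_Integration.integral_cong) (auto simp: bregman_def \<kappa>_def)
    also have "\<bar>\<dots>\<bar> \<le> (2 / ?\<eta> * B\<^sup>2) * t\<^sup>2"
    proof (rule LINT_unit_abs_le)
      show "AE x in unit_lborel. \<bar>bregman (\<rho> x + t * v x) (\<rho> x)\<bar> \<le> (2 / ?\<eta> * B\<^sup>2) * t\<^sup>2"
        using close[OF t]
      proof eventually_elim
        case (elim x)
        then have r: "\<rho> x \<in> {?\<eta>..1 - ?\<eta>}" "\<rho> x + t * v x \<in> {?\<eta>..1 - ?\<eta>}" "\<bar>t * v x\<bar> \<le> t * B"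
          by auto
        have "0 \<le> bregman (\<rho> x + t * v x) (\<rho> x)"
          using r \<delta>(1) by (intro bregman_nonneg) auto
        moreover have "bregman (\<rho> x + t * v x) (\<rho> x) \<le> 2 / ?\<eta> * (t * v x)\<^sup>2"
          using bregman_le[OF _ r(1,2)] \<delta>(1) by simp
        moreover have "(t * v x)\<^sup>2 \<le> (t * B)\<^sup>2"
          using r(3) by (rule abs_le_square_iff[THEN iffD1, OF order_trans[OF _ abs_ge_self]])
        then have "2 / ?\<eta> * (t * v x)\<^sup>2 \<le> 2 / ?\<eta> * (t * B)\<^sup>2"
          using \<delta>(1) by (intro mult_left_mono) auto
        ultimately show ?case
          by (simp add: power_mult_distrib mult_ac)
      qed
    qed (use \<delta>(1) in auto)
    finally show ?thesis .
  qed
  show ?thesis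
    by (rule that[OF _ prof exp]) (use \<delta>(1) B(2) in auto)
qed

lemma E_directional_derivative:
  assumes v: "v \<in> Linf"
  shows "((\<lambda>t. (E (\<lambda>x. \<rho> x + t * v x) - E \<rho>) / t) \<longlongrightarrow> pairing \<kappa> v) (at_right 0)"
    and "\<forall>\<^sub>F t in at_right 0. 0 < t \<and> (\<lambda>x. \<rho> x + t * v x) \<in> profiles"
proof -
  obtain \<tau> K where \<tau>: "0 < \<tau>" "\<And>t. 0 < t \<Longrightarrow> t < \<tau> \<Longrightarrow> (\<lambda>x. \<rho> x + t * v x) \<in> profiles"
    and K: "\<And>t. 0 < t \<Longrightarrow> t < \<tau> \<Longrightarrow> \<bar>E (\<lambda>x. \<rho> x + t * v x) - E \<rho> - t * pairing \<kappa> v\<bar> \<le> K * t\<^sup>2"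
    using E_expansion[OF v] by blast
  show "\<forall>\<^sub>F t in at_right 0. 0 < t \<and> (\<lambda>x. \<rho> x + t * v x) \<in> profiles"
    using eventually_at_right_real[OF \<tau>(1)] by eventually_elim (use \<tau>(2) in auto)
  have "((\<lambda>t. (E (\<lambda>x. \<rho> x + t * v x) - E \<rho>) / t - pairing \<kappa> v) \<longlongrightarrow> 0) (at_right 0)"
  proof (rule Lim_null_comparison)
    show "\<forall>\<^sub>F t in at_right 0. norm ((E (\<lambda>x. \<rho> x + t * v x) - E \<rho>) / t - pairing \<kappa> v) \<le> K * t"
      using eventually_at_right_real[OF \<tau>(1)]
    proof eventually_elim
      case (elim t)
      then have t: "0 < t" "t < \<tau>" by auto
      have "(E (\<lambda>x. \<rho> x + t * v x) - E \<rho>) / t - pairing \<kappa> v =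
          (E (\<lambda>x. \<rho> x + t * v x) - E \<rho> - t * pairing \<kappa> v) / t"
        using t by (simp add: field_simps)
      then show ?case
        using K[OF t] t by (simp add: field_simps power2_eq_square)
    qed
    show "((\<lambda>t. K * t) \<longlongrightarrow> 0) (at_right 0)"
      by (auto intro!: tendsto_eq_intros)
  qed
  then show "((\<lambda>t. (E (\<lambda>x. \<rho> x + t * v x) - E \<rho>) / t) \<longlongrightarrow> pairing \<kappa> v) (at_right 0)"
    by (rule Lim_null[THEN iffD2])
qed

lemma G_perturbed:
  assumes v: "v \<in> Linf" and w: "w \<in> lip_densities" and t: "(\<lambda>x. \<rho> x + t * v x) \<in> profiles"
  shows "G (\<lambda>x. \<rho> x + t * v x) w = G \<rho> w + (E (\<lambda>x. \<rho> x + t * v x) - E \<rho>) - t * pairing v (primitive \<phi>0 w)"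
proof -
  have "integrable unit_lborel (primitive \<phi>0 w)"
    by (intro continuous_unit_integrable primitive_continuous lip_densities_in_densities w)
  then have "pairing (\<lambda>x. \<rho> x + t * v x) (primitive \<phi>0 w)
      = pairing \<rho> (primitive \<phi>0 w) + t * pairing v (primitive \<phi>0 w)"
    using continuous_in_Linf[OF rho_cont] v by (intro pairing_add_scale Linf_mult_integrable)
  then show ?thesis
    by (simp add: G_eq rho_profile t lip_densities_in_densities[OF w])
qed

abbreviation S :: "(real \<Rightarrow> real) \<Rightarrow> ereal" where
  "S \<equiv> quasi_potential \<epsilon> \<phi>0 \<phi>1"

lemma gateaux_quotient_eq:
  assumes "0 < t" "S (\<lambda>x. \<rho> x + t * v x) = ereal a" "S \<rho> = ereal b"
  shows "gateaux_quotient S \<rho> l v t = ereal ((a - b) / t - pairing l v)"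
  unfolding gateaux_quotient_def assms(2,3) using assms(1) by (simp add: field_simps)

text \<open>A minimizer at \<open>\<rho>\<close> competes at the perturbed profile and bounds
  \<open>S\<close> there from above.\<close>

lemma gateaux_quotient_le:
  assumes v: "v \<in> Linf" and m: "minimizer \<rho> w" and t: "0 < t" "(\<lambda>x. \<rho> x + t * v x) \<in> profiles"
  shows "gateaux_quotient S \<rho> l v t \<le>
    ereal ((E (\<lambda>x. \<rho> x + t * v x) - E \<rho>) / t - pairing v (primitive \<phi>0 w) - pairing l v)"
proof -
  obtain w' where w': "minimizer (\<lambda>x. \<rho> x + t * v x) w'"
    using minimizer_exists[OF t(2)] by blast
  have w: "w \<in> lip_densities" using m by (simp add: minimizer_def)
  have "G (\<lambda>x. \<rho> x + t * v x) w' - G \<rho> w \<le> (E (\<lambda>x. \<rho> x + t * v x) - E \<rho>) - t * pairing v (primitive \<phi>0 w)"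
    using w' w G_perturbed[OF v w t(2)] by (auto simp: minimizer_def)
  then have "(G (\<lambda>x. \<rho> x + t * v x) w' - G \<rho> w) / t \<le>
      ((E (\<lambda>x. \<rho> x + t * v x) - E \<rho>) - t * pairing v (primitive \<phi>0 w)) / t"
    using t(1) by (intro divide_right_mono) auto
  then show ?thesis
    using t(1) unfolding gateaux_quotient_eq[OF t(1) quasi_potential_eq[OF t(2) w'] quasi_potential_eq[OF rho_profile m]]
    by (simp add: diff_divide_distrib)
qed

text \<open>The mirror image: a minimizer at the perturbed profile competes at
  \<open>\<rho>\<close>. Here \<open>w\<close> varies with \<open>t\<close>, so passing to the limit
  takes compactness.\<close>

lemma gateaux_quotient_ge:
  assumes v: "v \<in> Linf" and m: "minimizer (\<lambda>x. \<rho> x + t * v x) w" and t: "0 < t" "(\<lambda>x. \<rho> x + t * v x) \<in> profiles"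
  shows "ereal ((E (\<lambda>x. \<rho> x + t * v x) - E \<rho>) / t - pairing v (primitive \<phi>0 w) - pairing l v)
    \<le> gateaux_quotient S \<rho> l v t"
proof -
  obtain w' where w': "minimizer \<rho> w'"
    using minimizer_exists[OF rho_profile] by blast
  have w: "w \<in> lip_densities" using m by (simp add: minimizer_def)
  have "(E (\<lambda>x. \<rho> x + t * v x) - E \<rho>) - t * pairing v (primitive \<phi>0 w) \<le> G (\<lambda>x. \<rho> x + t * v x) w - G \<rho> w'"
    using w' w G_perturbed[OF v w t(2)] by (auto simp: minimizer_def)
  then have "((E (\<lambda>x. \<rho> x + t * v x) - E \<rho>) - t * pairing v (primitive \<phi>0 w)) / t
      \<le> (G (\<lambda>x. \<rho> x + t * v x) w - G \<rho> w') / t"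
    using t(1) by (intro divide_right_mono) auto
  then show ?thesis
    using t(1) unfolding gateaux_quotient_eq[OF t(1) quasi_potential_eq[OF t(2) m] quasi_potential_eq[OF rho_profile w']]
    by (simp add: diff_divide_distrib)
qed

lemma subdiff_le:
  assumes l: "l \<in> gateaux_subdiff S \<rho>" and m: "minimizer \<rho> w" and v: "v \<in> Linf"
  shows "pairing l v \<le> pairing \<kappa> v - pairing v (primitive \<phi>0 w)"
proof -
  let ?F = "\<lambda>t. (E (\<lambda>x. \<rho> x + t * v x) - E \<rho>) / t - pairing v (primitive \<phi>0 w) - pairing l v"
  have "((\<lambda>t. ereal (?F t)) \<longlongrightarrow> ereal (pairing \<kappa> v - pairing v (primitive \<phi>0 w) - pairing l v)) (at_right 0)"
    by (intro tendsto_intros E_directional_derivative v)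
  then have lim: "Liminf (at_right 0) (\<lambda>t. ereal (?F t)) = ereal (pairing \<kappa> v - pairing v (primitive \<phi>0 w) - pairing l v)"
    by (intro lim_imp_Liminf) auto
  have "0 \<le> Liminf (at_right 0) (gateaux_quotient S \<rho> l v)"
    using l v by (auto simp: gateaux_subdiff_def)
  also have "\<dots> \<le> Liminf (at_right 0) (\<lambda>t. ereal (?F t))"
    by (intro Liminf_mono eventually_mono[OF E_directional_derivative(2)[OF v]]) (use gateaux_quotient_le v m in auto)
  finally show ?thesis
    unfolding lim by simp
qed

text \<open>The inequality in \<open>subdiff_le\<close> holds in every direction, in particular for
  the sign of the difference of the two sides, which makes the L1 norm of that difference
  nonpositive. As \<open>w\<close> is an arbitrary minimizer, the subdifferential is empty when two
  minimizers differ on the unit interval.\<close>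

lemma subdiff_eq:
  assumes l: "l \<in> gateaux_subdiff S \<rho>" and m: "minimizer \<rho> w"
  shows "AE x in unit_lborel. l x = \<kappa> x - primitive \<phi>0 w x"
proof -
  have w: "w \<in> lip_densities" using m by (simp add: minimizer_def)
  have li: "integrable unit_lborel l"
    using l by (simp add: gateaux_subdiff_def L1_def)
  have ki: "integrable unit_lborel \<kappa>" and pi: "integrable unit_lborel (primitive \<phi>0 w)"
    by (intro continuous_unit_integrable kappa_cont primitive_continuous lip_densities_in_densities w)+
  have [measurable]: "l \<in> borel_measurable unit_lborel" "\<kappa> \<in> borel_measurable unit_lborel"
    "primitive \<phi>0 w \<in> borel_measurable unit_lborel"
    using li ki pi by auto
  let ?d = "\<lambda>x. l x - (\<kappa> x - primitive \<phi>0 w x)"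
  let ?v = "\<lambda>x. sgn (?d x)"
  have v: "?v \<in> Linf"
    unfolding Linf_def by (auto intro!: exI[of _ 1] simp: sgn_real_def)
  note i = Linf_mult_integrable[OF v li] Linf_mult_integrable[OF v ki] Linf_mult_integrable[OF v pi]
  have "(LINT x|unit_lborel. \<bar>?d x\<bar>) = (LINT x|unit_lborel. ?v x * l x - (?v x * \<kappa> x - ?v x * primitive \<phi>0 w x))"
    by (intro Bochner_Integration.integral_cong) (auto simp: sgn_real_def)
  also have "\<dots> = pairing l ?v - (pairing \<kappa> ?v - pairing ?v (primitive \<phi>0 w))"
    unfolding pairing_def using i by (simp add: mult.commute)
  also have "\<dots> \<le> 0"
    using subdiff_le[OF l m v] by simp
  finally have "(LINT x|unit_lborel. \<bar>?d x\<bar>) = 0"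
    by (intro antisym integral_nonneg_AE) auto
  then have "AE x in unit_lborel. \<bar>?d x\<bar> = 0"
    using li ki pi by (subst integral_nonneg_eq_0_iff_AE[symmetric]) auto
  then show ?thesis
    by eventually_elim simp
qed

text \<open>Minimizers at the perturbed profiles accumulate at a minimizer for
  \<open>\<rho>\<close>, and \<open>gateaux_quotient_ge\<close> passes to the limit along the
  subsequence. The minimizer depends on \<open>v\<close>, so \<open>l\<close> need not come from a
  single one.\<close>

lemma superdiff_minimizer:
  assumes l: "l \<in> gateaux_superdiff S \<rho>" and v: "v \<in> Linf"
  obtains w where "minimizer \<rho> w" "pairing \<kappa> v - pairing v (primitive \<phi>0 w) \<le> pairing l v"
proof -
  obtain \<tau> where \<tau>: "0 < \<tau>" "\<And>t. 0 < t \<Longrightarrow> t < \<tau> \<Longrightarrow> (\<lambda>x. \<rho> x + t * v x) \<in> profiles"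
    using E_expansion[OF v] by metis
  \<comment> \<open>The summand 2 keeps \<open>t n\<close> strictly below \<tau>, also for
    \<open>n = 0\<close>.\<close>
  define t where "t n = \<tau> / (real n + 2)" for n
  have t: "0 < t n" "(\<lambda>x. \<rho> x + t n * v x) \<in> profiles" for n
  proof -
    show "0 < t n" using \<tau>(1) by (simp add: t_def)
    moreover have "t n < \<tau>" using \<tau>(1) by (simp add: t_def field_simps add_pos_nonneg)
    ultimately show "(\<lambda>x. \<rho> x + t n * v x) \<in> profiles" by (rule \<tau>(2))
  qed
  have t0: "filterlim t (at_right 0) sequentially"
    unfolding filterlim_at_right_to_0 filterlim_at using t(1)
    by (auto simp: t_def[abs_def] intro!: always_eventually) real_asymp
  obtain f where f: "\<And>n. minimizer (\<lambda>x. \<rho> x + t n * v x) (f n)"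
    using minimizer_exists[OF t(2)] by metis
  have fW: "f n \<in> lip_densities" for n
    using f[of n] by (simp add: minimizer_def)
  obtain w r where w: "w \<in> lip_densities" and r: "strict_mono (r :: nat \<Rightarrow> nat)"
    and ul: "uniform_limit {0..1} (\<lambda>n. f (r n)) w sequentially"
    using lip_densities_seq_compact[OF fW] .
  have tr: "filterlim (\<lambda>n. t (r n)) (at_right 0) sequentially"
    using filterlim_compose[OF t0 filterlim_subseq[OF r]] .
  then have tr0: "(\<lambda>n. t (r n)) \<longlonglongrightarrow> 0"
    by (rule filterlim_mono[OF _ at_within_le_nhds order_refl])
  note pv = pairing_primitive_tendsto[OF Linf_integrable[OF v] fW w ul]
  note pr = pairing_primitive_tendsto[OF profiles_integrable[OF rho_profile] fW w ul]
  have "minimizer \<rho> w"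
    unfolding minimizer_def
  proof (intro conjI ballI w)
    fix w' assume w': "w' \<in> lip_densities"
    \<comment> \<open>Minimality of \<open>f (r n)\<close> at the perturbed profile, rewritten by
      \<open>G_perturbed\<close>; the difference of \<open>E\<close> values is common to both sides
      and cancels.\<close>
    have "G \<rho> (f (r n)) - t (r n) * pairing v (primitive \<phi>0 (f (r n))) \<le> G \<rho> w' - t (r n) * pairing v (primitive \<phi>0 w')" for n
      using f[of "r n"] w' G_perturbed[OF v fW t(2)] G_perturbed[OF v w' t(2)] by (fastforce simp: minimizer_def)
    moreover have "(\<lambda>n. G \<rho> (f (r n)) - t (r n) * pairing v (primitive \<phi>0 (f (r n)))) \<longlonglongrightarrow>
        G \<rho> w - 0 * pairing v (primitive \<phi>0 w)"
      unfolding G_eq[OF rho_profile lip_densities_in_densities[OF fW]] G_eq[OF rho_profile lip_densities_in_densities[OF w]]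
      by (intro tendsto_intros C_tendsto[OF fW w ul] pv pr tr0)
    moreover have "(\<lambda>n. G \<rho> w' - t (r n) * pairing v (primitive \<phi>0 w')) \<longlonglongrightarrow> G \<rho> w' - 0 * pairing v (primitive \<phi>0 w')"
      by (intro tendsto_intros tr0)
    ultimately show "G \<rho> w \<le> G \<rho> w'"
      using LIMSEQ_le by fastforce
  qed
  moreover have "pairing \<kappa> v - pairing v (primitive \<phi>0 w) \<le> pairing l v"
  proof (rule field_le_epsilon)
    fix e :: real assume e: "0 < e"
    let ?F = "\<lambda>n. (E (\<lambda>x. \<rho> x + t (r n) * v x) - E \<rho>) / t (r n) - pairing v (primitive \<phi>0 (f (r n))) - pairing l v"
    have F: "?F \<longlonglongrightarrow> pairing \<kappa> v - pairing v (primitive \<phi>0 w) - pairing l v"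
      by (intro tendsto_intros pv filterlim_compose[OF E_directional_derivative(1)[OF v] tr])
    have "Limsup (at_right 0) (gateaux_quotient S \<rho> l v) \<le> 0"
      using l v by (auto simp: gateaux_superdiff_def)
    also have "0 < ereal e" using e by simp
    finally have "\<forall>\<^sub>F s in at_right 0. gateaux_quotient S \<rho> l v s < ereal e"
      by (rule Limsup_lessD)
    then have "\<forall>\<^sub>F n in sequentially. gateaux_quotient S \<rho> l v (t (r n)) < ereal e"
      using tr by (rule eventually_compose_filterlim)
    then have "\<forall>\<^sub>F n in sequentially. ?F n \<le> e"
    proof eventually_elim
      case (elim n)
      have "ereal (?F n) < ereal e"
        by (rule order_le_less_trans[OF gateaux_quotient_ge[OF v f t] elim])
      then show ?case by simp
    qed
    then have "pairing \<kappa> v - pairing v (primitive \<phi>0 w) - pairing l v \<le> e"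
      by (intro tendsto_upperbound[OF F]) auto
    then show "pairing \<kappa> v - pairing v (primitive \<phi>0 w) \<le> pairing l v + e" by simp
  qed
  ultimately show ?thesis by (rule that)
qed

end

section \<open>The convex hull of the minimizers\<close>

text \<open>A Taylor bound reflecting a second derivative of at most 1, derived from 2xy \<le> x^2 +
  y^2 for the two square roots.\<close>

lemma sqrt_1_plus_square_le:
  "sqrt (1 + (a + h)\<^sup>2) \<le> sqrt (1 + a\<^sup>2) + a / sqrt (1 + a\<^sup>2) * h + h\<^sup>2 / 2" for a h :: real
proof -
  let ?S = "sqrt (1 + a\<^sup>2)"
  have S: "1 \<le> ?S" "?S\<^sup>2 = 1 + a\<^sup>2"
    by simp_all
  have pos: "0 < 1 + a\<^sup>2"
    using zero_le_power2[of a] by linarith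
  have "sqrt (1 + (a + h)\<^sup>2) * ?S \<le> ((1 + (a + h)\<^sup>2) + ?S\<^sup>2) / 2"
    using sum_squares_bound[of "sqrt (1 + (a + h)\<^sup>2)" ?S] by simp
  then have "sqrt (1 + (a + h)\<^sup>2) \<le> ((1 + (a + h)\<^sup>2) + ?S\<^sup>2) / (2 * ?S)"
    using S(1) by (subst pos_le_divide_eq) (simp_all add: mult_ac pos)
  also have "(1 + (a + h)\<^sup>2) + ?S\<^sup>2 = 2 * ?S\<^sup>2 + 2 * (a * h) + h\<^sup>2"
    using S(2) by (simp add: power2_sum)
  also have "(2 * ?S\<^sup>2 + 2 * (a * h) + h\<^sup>2) / (2 * ?S) = ?S + a / ?S * h + h\<^sup>2 / (2 * ?S)"
    using S(1) by (simp add: add_divide_distrib power2_eq_square[of ?S] pos del: real_sqrt_pow2 real_sqrt_mult_self)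
  also have "h\<^sup>2 / (2 * ?S) \<le> h\<^sup>2 / 2"
    using S(1) pos by (intro divide_left_mono) auto
  finally show ?thesis by simp
qed

context quasi_potential_data
begin

lemma lip_densities_convex:
  assumes a: "a \<in> lip_densities" and b: "b \<in> lip_densities" and s: "0 \<le> s" "s \<le> 1"
  shows "(\<lambda>x. a x + s * (b x - a x)) \<in> lip_densities"
  unfolding lip_densities_def mem_Collect_eq
proof (intro conjI ballI)
  have c: "a x + s * (b x - a x) = (1 - s) * a x + s * b x" for x
    by (simp add: algebra_simps)
  fix x y :: real assume xy: "x \<in> {0..1}" "y \<in> {0..1}"
  have "\<bar>(a x + s * (b x - a x)) - (a y + s * (b y - a y))\<bar> = \<bar>(1 - s) * (a x - a y) + s * (b x - b y)\<bar>"
    unfolding c by (simp add: algebra_simps)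
  also have "\<dots> \<le> (1 - s) * \<bar>a x - a y\<bar> + s * \<bar>b x - b y\<bar>"
    using s by (intro order_trans[OF abs_triangle_ineq]) (simp add: abs_mult)
  also have "\<dots> \<le> (1 - s) * (\<bar>x - y\<bar> / \<epsilon>\<^sup>2) + s * (\<bar>x - y\<bar> / \<epsilon>\<^sup>2)"
    using a b s xy by (intro add_mono mult_left_mono) (auto simp: lip_densities_def)
  finally show "\<bar>(a x + s * (b x - a x)) - (a y + s * (b y - a y))\<bar> \<le> \<bar>x - y\<bar> / \<epsilon>\<^sup>2"
    by (simp only: distrib_right[symmetric]) simp
  have r: "0 \<le> a x" "a x \<le> 1 / \<epsilon>" "0 \<le> b x" "b x \<le> 1 / \<epsilon>"
    using a b xy by (auto simp: lip_densities_def)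
  show "0 \<le> a x + s * (b x - a x)"
    unfolding c using r s by (intro add_nonneg_nonneg mult_nonneg_nonneg) auto
  show "a x + s * (b x - a x) \<le> 1 / \<epsilon>"
    unfolding c using r s by (intro convex_bound_le) auto
next
  have "integrable unit_lborel a" "integrable unit_lborel b"
    by (intro densities_integrable lip_densities_in_densities a b)+
  then show "(LINT x|unit_lborel. a x + s * (b x - a x)) = \<phi>1 - \<phi>0"
    using a b by (simp add: lip_densities_def)
qed

text \<open>The penalty \<open>sqrt (1 + t\<^sup>2)\<close> is strictly convex with a bounded derivative, so that
  the separating direction at the point of \<open>lip_densities\<close> closest to \<open>\<psi> \<in> L\<^sup>1\<close> lies in \<open>L\<^sup>\<infinity>\<close>.\<close>

lemma closed_convex_separation:
  assumes \<psi>: "integrable unit_lborel \<psi>"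
    and sep: "\<And>v. v \<in> Linf \<Longrightarrow> \<exists>w\<in>lip_densities. pairing v \<psi> \<le> pairing v (primitive \<phi>0 w)"
  obtains w where "w \<in> lip_densities" "AE x in unit_lborel. \<psi> x = primitive \<phi>0 w x"
proof -
  define J where "J w = (LINT x|unit_lborel. sqrt (1 + (\<psi> x - primitive \<phi>0 w x)\<^sup>2))" for w
  have [measurable]: "\<psi> \<in> borel_measurable unit_lborel"
    using \<psi> by auto
  have pmeas[measurable]: "primitive \<phi>0 w \<in> borel_measurable unit_lborel" if "w \<in> lip_densities" for w
    by (intro continuous_unit_measurable primitive_continuous lip_densities_in_densities that)
  have sqrt_le: "sqrt (1 + a\<^sup>2) \<le> 1 + \<bar>a\<bar>" for a :: real
    by (rule real_le_lsqrt) (auto simp: power2_sum)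
  let ?R = "\<bar>\<phi>0\<bar> + 1 / \<epsilon>"
  have bound: "sqrt (1 + (\<psi> x - primitive \<phi>0 w x)\<^sup>2) \<le> 1 + \<bar>\<psi> x\<bar> + ?R" if "w \<in> lip_densities" "x \<in> {0..1}" for w x
    using sqrt_le[of "\<psi> x - primitive \<phi>0 w x"] primitive_lip_densities_abs_le[OF that, of \<phi>0] by linarith
  have Rint: "integrable unit_lborel (\<lambda>x. 1 + \<bar>\<psi> x\<bar> + ?R)"
    using \<psi> by auto
  have Jint: "integrable unit_lborel (\<lambda>x. sqrt (1 + (\<psi> x - primitive \<phi>0 w x)\<^sup>2))" if w: "w \<in> lip_densities" for w
  proof (rule Bochner_Integration.integrable_bound[OF Rint])
    show "(\<lambda>x. sqrt (1 + (\<psi> x - primitive \<phi>0 w x)\<^sup>2)) \<in> borel_measurable unit_lborel"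
      using pmeas[OF w] by measurable
    show "AE x in unit_lborel. norm (sqrt (1 + (\<psi> x - primitive \<phi>0 w x)\<^sup>2)) \<le> norm (1 + \<bar>\<psi> x\<bar> + ?R)"
      using bound[OF w] by (intro AE_unit_lborelI) force
  qed
  have "\<exists>w\<in>lip_densities. \<forall>w'\<in>lip_densities. J w \<le> J w'"
  proof (rule lip_densities_attains_min)
    fix f w assume f: "\<And>n. f n \<in> lip_densities" and w: "w \<in> lip_densities" and ul: "uniform_limit {0..1} f w sequentially"
    show "(\<lambda>n. J (f n)) \<longlonglongrightarrow> J w"
      unfolding J_def
    proof (rule integral_dominated_convergence[OF _ _ Rint])
      show "AE x in unit_lborel. norm (sqrt (1 + (\<psi> x - primitive \<phi>0 (f n) x)\<^sup>2)) \<le> 1 + \<bar>\<psi> x\<bar> + ?R" for n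
        using bound[OF f] by (intro AE_unit_lborelI) auto
      show "AE x in unit_lborel. (\<lambda>n. sqrt (1 + (\<psi> x - primitive \<phi>0 (f n) x)\<^sup>2))
          \<longlonglongrightarrow> sqrt (1 + (\<psi> x - primitive \<phi>0 w x)\<^sup>2)"
        by (intro AE_I2 tendsto_intros primitive_tendsto f w ul)
    qed (use Jint[OF w] Jint[OF f] in auto)
  qed
  then obtain w where w: "w \<in> lip_densities" and min: "\<And>w'. w' \<in> lip_densities \<Longrightarrow> J w \<le> J w'"
    by blast
  let ?d = "\<lambda>x. \<psi> x - primitive \<phi>0 w x"
  \<comment> \<open>The derivative of the penalty at the residual \<open>?d\<close>, bounded by
    1.\<close>
  let ?v = "\<lambda>x. ?d x / sqrt (1 + (?d x)\<^sup>2)"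
  note [measurable] = pmeas[OF w]
  have pint: "integrable unit_lborel (primitive \<phi>0 w')" if "w' \<in> lip_densities" for w'
    by (intro continuous_unit_integrable primitive_continuous lip_densities_in_densities that)
  have v: "?v \<in> Linf"
    unfolding Linf_def
  proof (intro CollectI conjI exI[of _ 1] AE_I2)
    fix x
    have "\<bar>?d x\<bar> \<le> sqrt (1 + (?d x)\<^sup>2)"
      by (rule real_le_rsqrt) simp
    then show "\<bar>?v x\<bar> \<le> 1"
      by (simp add: abs_divide add_pos_nonneg)
  qed measurable
  obtain w' where w': "w' \<in> lip_densities" and le: "pairing ?v \<psi> \<le> pairing ?v (primitive \<phi>0 w')"
    using sep[OF v] by blast
  let ?q = "\<lambda>x. primitive \<phi>0 w' x - primitive \<phi>0 w x"
  have qc: "continuous_on {0..1} ?q"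
    by (intro continuous_intros primitive_continuous lip_densities_in_densities w w')
  have vq: "integrable unit_lborel (\<lambda>x. ?v x * ?q x)"
    by (rule Linf_mult_integrable[OF v continuous_unit_integrable[OF qc]])
  have q2: "integrable unit_lborel (\<lambda>x. (?q x)\<^sup>2)"
    by (intro continuous_unit_integrable continuous_intros qc)
  \<comment> \<open>First-order optimality of \<open>w\<close> towards \<open>w'\<close>: at
    parameter \<open>s\<close> the penalty changes by at most - s times the left integral plus a
    remainder of order s^2; minimality and division by \<open>s\<close> give the bound.\<close>
  have step: "(LINT x|unit_lborel. ?v x * ?q x) \<le> s * ((LINT x|unit_lborel. (?q x)\<^sup>2) / 2)" if s: "0 < s" "s \<le> 1" for s
  proof -
    let ?ws = "\<lambda>x. w x + s * (w' x - w x)"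
    have ws: "?ws \<in> lip_densities"
      using lip_densities_convex[OF w w'] s by simp
    have "primitive \<phi>0 ?ws x = primitive \<phi>0 w x + s * ?q x" for x
    proof -
      have i: "integrable unit_lborel w" "integrable unit_lborel w'"
        by (intro densities_integrable lip_densities_in_densities w w')+
      have "(LINT y|unit_lborel. indicator {..x} y * ?ws y) =
        (LINT y|unit_lborel. indicator {..x} y * w y + s * (indicator {..x} y * w' y - indicator {..x} y * w y))"
        by (intro Bochner_Integration.integral_cong) (auto simp: algebra_simps)
      also have "\<dots> = (LINT y|unit_lborel. indicator {..x} y * w y) +
         s * ((LINT y|unit_lborel. indicator {..x} y * w' y) - (LINT y|unit_lborel. indicator {..x} y * w y))"
        using i by (simp add: integrable_indicator_mult)
      finally show ?thesis by (simp add: primitive_def)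
    qed
    then have d: "\<psi> x - primitive \<phi>0 ?ws x = ?d x + (- s * ?q x)" for x
      by simp
    have int: "integrable unit_lborel (\<lambda>x. sqrt (1 + (?d x)\<^sup>2) + (- s * (?v x * ?q x) + s\<^sup>2 / 2 * (?q x)\<^sup>2))"
      by (intro Bochner_Integration.integrable_add integrable_mult_right Jint w vq q2)
    have "J ?ws \<le> (LINT x|unit_lborel. sqrt (1 + (?d x)\<^sup>2) + (- s * (?v x * ?q x) + s\<^sup>2 / 2 * (?q x)\<^sup>2))"
      unfolding J_def
    proof (rule integral_mono[OF Jint[OF ws] int])
      fix x
      show "sqrt (1 + (\<psi> x - primitive \<phi>0 ?ws x)\<^sup>2) \<le> sqrt (1 + (?d x)\<^sup>2) + (- s * (?v x * ?q x) + s\<^sup>2 / 2 * (?q x)\<^sup>2)"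
        unfolding d using sqrt_1_plus_square_le[of "?d x" "- s * ?q x"] by (simp add: power_mult_distrib mult_ac)
    qed
    also have "\<dots> = J w + (- s * (LINT x|unit_lborel. ?v x * ?q x) + s\<^sup>2 / 2 * (LINT x|unit_lborel. (?q x)\<^sup>2))"
      unfolding J_def using Jint[OF w] vq q2
      by (simp only: Bochner_Integration.integral_add Bochner_Integration.integrable_add
          integrable_mult_right integral_mult_right_zero)
    finally have "s * (LINT x|unit_lborel. ?v x * ?q x) \<le> s * (s * ((LINT x|unit_lborel. (?q x)\<^sup>2) / 2))"
      using min[OF ws] by (simp add: power2_eq_square)
    then show ?thesis
      using s(1) by (simp only: mult_le_cancel_left_pos)
  qed
  have "(LINT x|unit_lborel. ?v x * ?q x) \<le> 0"
  proof (rule tendsto_lowerbound)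
    show "((\<lambda>s. s * ((LINT x|unit_lborel. (?q x)\<^sup>2) / 2)) \<longlongrightarrow> 0) (at_right 0)"
      by (rule tendsto_mult_left_zero) (rule tendsto_ident_at)
    show "\<forall>\<^sub>F s in at_right 0. (LINT x|unit_lborel. ?v x * ?q x) \<le> s * ((LINT x|unit_lborel. (?q x)\<^sup>2) / 2)"
    proof (rule eventually_mono[OF eventually_at_right_real[OF zero_less_one]])
      fix s :: real assume "s \<in> {0<..<1}"
      then show "(LINT x|unit_lborel. ?v x * ?q x) \<le> s * ((LINT x|unit_lborel. (?q x)\<^sup>2) / 2)"
        by (intro step) auto
    qed
  qed simp
  \<comment> \<open>Together with \<open>le\<close> this makes the integral of
    \<open>?v x * ?d x\<close> nonpositive, although the integrand, the square of
    \<open>?d x\<close> over a positive root, is nonnegative.\<close>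
  then have "pairing ?v (primitive \<phi>0 w') \<le> pairing ?v (primitive \<phi>0 w)"
    unfolding pairing_def right_diff_distrib
    using Linf_mult_integrable[OF v pint[OF w]] Linf_mult_integrable[OF v pint[OF w']] by simp
  moreover have vd: "integrable unit_lborel (\<lambda>x. ?v x * ?d x)"
    by (rule Linf_mult_integrable[OF v]) (use \<psi> pint[OF w] in auto)
  moreover have "(LINT x|unit_lborel. ?v x * ?d x) = pairing ?v \<psi> - pairing ?v (primitive \<phi>0 w)"
    unfolding pairing_def right_diff_distrib[of "?v _"]
    using Linf_mult_integrable[OF v pint[OF w]] Linf_mult_integrable[OF v \<psi>] by (rule Bochner_Integration.integral_diff[rotated])
  ultimately have "(LINT x|unit_lborel. ?v x * ?d x) \<le> 0"
    using le by linarith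
  moreover have nn: "0 \<le> ?v x * ?d x" for x
    by (simp add: add_nonneg_nonneg)
  ultimately have "(LINT x|unit_lborel. ?v x * ?d x) = 0"
    by (intro antisym integral_nonneg_AE) auto
  then have "AE x in unit_lborel. ?v x * ?d x = 0"
    using integral_nonneg_eq_0_iff_AE[OF vd] nn by auto
  then have "AE x in unit_lborel. \<psi> x = primitive \<phi>0 w x"
  proof eventually_elim
    case (elim x)
    have "sqrt (1 + (?d x)\<^sup>2) \<noteq> 0"
      by (simp add: add_nonneg_eq_0_iff)
    then show ?case using elim by simp
  qed
  with w show ?thesis by (rule that)
qed

end

section \<open>The Hamiltonian on the superdifferential\<close>

context smooth_profile
begin

text \<open>\<open>superdiff_minimizer\<close> supplies the hypothesis of the separation lemma. Only
  membership in \<open>lip_densities\<close> is retained, which is weaker than membership in the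
  closed convex hull of the minimizers; the sign of \<open>Q\<close> is later obtained from the
  superdifferential condition itself.\<close>

lemma superdiff_eq:
  assumes l: "l \<in> gateaux_superdiff S \<rho>"
  obtains w where "w \<in> lip_densities" "AE x in unit_lborel. l x = \<kappa> x - primitive \<phi>0 w x"
proof -
  have li: "integrable unit_lborel l" and ki: "integrable unit_lborel \<kappa>"
    using l continuous_unit_integrable[OF kappa_cont] by (simp_all add: gateaux_superdiff_def L1_def)
  obtain w where "w \<in> lip_densities" "AE x in unit_lborel. \<kappa> x - l x = primitive \<phi>0 w x"
  proof (rule closed_convex_separation)
    fix v assume v: "v \<in> Linf"
    obtain w where w: "minimizer \<rho> w" "pairing \<kappa> v - pairing v (primitive \<phi>0 w) \<le> pairing l v"
      using superdiff_minimizer[OF l v] .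
    have "pairing v (\<lambda>x. \<kappa> x - l x) = pairing \<kappa> v - pairing l v"
      unfolding pairing_def right_diff_distrib
      using Linf_mult_integrable[OF v li] Linf_mult_integrable[OF v ki] by (simp add: mult.commute)
    then show "\<exists>w\<in>lip_densities. pairing v (\<lambda>x. \<kappa> x - l x) \<le> pairing v (primitive \<phi>0 w)"
      using w by (intro bexI[of _ w]) (auto simp: minimizer_def)
  qed (use li ki in auto)
  then show ?thesis
    by (intro that[of w]) (auto elim!: eventually_mono)
qed

text \<open>By convexity it suffices to find a minimizer \<open>u\<close> for which the derivative of \<open>Q\<close> at \<open>w\<close> in the
  direction \<open>u - w\<close> is nonnegative. That derivative is the integral of \<open>- m (u - w)\<close>; if \<open>m\<close> were
  \<open>C\<^sup>1\<close>, integration by parts and the superdifferential condition in direction \<open>m'\<close> would give it.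
  As \<open>m\<close> is only continuous, it is approximated by polynomials \<open>g\<close>.\<close>

lemma Q_superdiff_le:
  assumes l: "l \<in> gateaux_superdiff S \<rho>" and w: "w \<in> lip_densities"
    and lw: "AE x in unit_lborel. l x = \<kappa> x - primitive \<phi>0 w x"
  shows "Q w \<le> 0"
proof (rule field_le_epsilon)
  fix e :: real assume e: "0 < e"
  let ?\<sigma> = "\<lambda>x. mobility (\<rho> x)"
  \<comment> \<open>\<open>- ?m x\<close> is the derivative of the integrand of \<open>Q\<close>
    with respect to the value of \<open>w\<close>.\<close>
  let ?m = "\<lambda>x. \<epsilon> * \<rho>' x + ?\<sigma> x - 2 * \<epsilon> * ?\<sigma> x * w x"
  have \<sigma>c: "continuous_on {0..1} ?\<sigma>"
    unfolding mobility_def by (intro continuous_intros rho_cont)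
  have "continuous_on {0..1} ?m"
    by (intro continuous_intros \<sigma>c rho'_cont lip_densities_continuous w)
  \<comment> \<open>The error e * \<epsilon> is tuned to \<bar>u - w\<bar> \<le> 1/\<epsilon>, so
    that replacing \<open>?m\<close> by \<open>g\<close> costs at most \<open>e\<close>.\<close>
  then obtain g where g: "real_polynomial_function g" "\<And>x. x \<in> {0..1} \<Longrightarrow> \<bar>?m x - g x\<bar> < e * \<epsilon>"
    using Stone_Weierstrass_real_polynomial_function[of "{0..1}" ?m "e * \<epsilon>"] e eps_pos by auto
  obtain g' where g': "real_polynomial_function g'" "\<And>x. (g has_real_derivative g' x) (at x)"
    using has_real_derivative_polynomial_function[OF g(1)] by blast
  have gc: "continuous_on {0..1} g" "continuous_on {0..1} g'"
    using g(1) g'(1) by (auto intro!: continuous_at_imp_continuous_on continuous_real_polymonial_function)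
  \<comment> \<open>After integration by parts, testing the primitives against \<open>g'\<close>
    amounts to testing \<open>u - w\<close> against \<open>g\<close>, hence nearly against
    \<open>?m\<close>.\<close>
  obtain u where u: "minimizer \<rho> u" "pairing \<kappa> g' - pairing g' (primitive \<phi>0 u) \<le> pairing l g'"
    using superdiff_minimizer[OF l continuous_in_Linf[OF gc(2)]] .
  have uW: "u \<in> lip_densities" using u(1) by (simp add: minimizer_def)
  have [measurable]: "l \<in> borel_measurable unit_lborel"
    using l by (auto simp: gateaux_superdiff_def L1_def)
  note pc = primitive_continuous[OF lip_densities_in_densities[OF w]] primitive_continuous[OF lip_densities_in_densities[OF uW]]
  note [measurable] = continuous_unit_measurable[OF kappa_cont] continuous_unit_measurable[OF gc(2)]
     continuous_unit_measurable[OF pc(1)]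
  have "pairing l g' = (LINT x|unit_lborel. (\<kappa> x - primitive \<phi>0 w x) * g' x)"
    unfolding pairing_def
  proof (rule integral_cong_AE)
    show "AE x in unit_lborel. l x * g' x = (\<kappa> x - primitive \<phi>0 w x) * g' x"
      using lw by eventually_elim simp
  qed measurable
  also have "\<dots> = pairing \<kappa> g' - pairing g' (primitive \<phi>0 w)"
    unfolding pairing_def left_diff_distrib mult.commute[of "g' _"]
    by (intro Bochner_Integration.integral_diff continuous_unit_integrable continuous_intros kappa_cont gc pc)
  finally have "pairing g' (primitive \<phi>0 w) \<le> pairing g' (primitive \<phi>0 u)"
    using u(2) by simp
  moreover have "(LINT x|unit_lborel. g' x * (primitive \<phi>0 u x - primitive \<phi>0 w x))
      = pairing g' (primitive \<phi>0 u) - pairing g' (primitive \<phi>0 w)"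
    unfolding pairing_def right_diff_distrib
    by (intro Bochner_Integration.integral_diff continuous_unit_integrable continuous_intros gc pc)
  ultimately have 1: "0 \<le> (LINT x|unit_lborel. g' x * (primitive \<phi>0 u x - primitive \<phi>0 w x))"
    by simp
  \<comment> \<open>Both primitives equal \<phi>0 at 0 and \<phi>1 at 1, so no boundary term is
    left.\<close>
  have "(LINT x|unit_lborel. g' x * (primitive \<phi>0 u x - primitive \<phi>0 w x) + g x * (u x - w x))
      = g 1 * (primitive \<phi>0 u 1 - primitive \<phi>0 w 1) - g 0 * (primitive \<phi>0 u 0 - primitive \<phi>0 w 0)"
  proof (rule LINT_unit_FTC)
    show "((\<lambda>x. g x * (primitive \<phi>0 u x - primitive \<phi>0 w x)) has_real_derivative
        g' x * (primitive \<phi>0 u x - primitive \<phi>0 w x) + g x * (u x - w x)) (at x within {0..1})" if "x \<in> {0..1}" for x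
      by (rule derivative_eq_intros has_field_derivative_at_within[OF g'(2)] primitive_has_derivative
          lip_densities_continuous uW w that refl)+ simp
  qed (intro continuous_intros gc pc lip_densities_continuous uW w)
  also have "\<dots> = 0"
    by (simp add: primitive_lip_densities_1[OF uW] primitive_lip_densities_1[OF w] primitive_0)
  finally have "(LINT x|unit_lborel. g' x * (primitive \<phi>0 u x - primitive \<phi>0 w x))
      + (LINT x|unit_lborel. g x * (u x - w x)) = 0"
    by (subst (asm) Bochner_Integration.integral_add)
      (intro continuous_unit_integrable continuous_intros gc pc lip_densities_continuous uW w | assumption)+
  then have 2: "(LINT x|unit_lborel. g x * (u x - w x)) \<le> 0"
    using 1 by simp
  have "Q w = (LINT x|unit_lborel. (\<rho>' x - ?\<sigma> x * w x) * (1 - \<epsilon> * w x))"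
    by (simp add: Q_def)
  also have "\<dots> \<le> (LINT x|unit_lborel. ((\<rho>' x - ?\<sigma> x * u x) * (1 - \<epsilon> * u x) + g x * (u x - w x)) + e)"
  proof (rule integral_mono)
    show "integrable unit_lborel (\<lambda>x. (\<rho>' x - ?\<sigma> x * w x) * (1 - \<epsilon> * w x))"
      "integrable unit_lborel (\<lambda>x. ((\<rho>' x - ?\<sigma> x * u x) * (1 - \<epsilon> * u x) + g x * (u x - w x)) + e)"
      by (intro continuous_unit_integrable continuous_intros \<sigma>c rho'_cont gc lip_densities_continuous uW w)+
    fix x assume "x \<in> space unit_lborel"
    then have x: "x \<in> {0..1}" by simp
    let ?z = "u x - w x"
    \<comment> \<open>An exact second-order expansion at \<open>w\<close>; the sign of its quadratic
      term is the convexity of \<open>Q\<close>.\<close>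
    have "(\<rho>' x - ?\<sigma> x * u x) * (1 - \<epsilon> * u x) - (\<rho>' x - ?\<sigma> x * w x) * (1 - \<epsilon> * w x) =
        - (?m x * ?z) + \<epsilon> * ?\<sigma> x * ?z\<^sup>2"
      by (simp add: algebra_simps power2_eq_square)
    moreover have "0 \<le> \<epsilon> * ?\<sigma> x * ?z\<^sup>2"
      using eps_pos rho_range[OF x] by (simp add: mobility_def)
    moreover have "?m x * ?z - g x * ?z \<le> e"
    proof -
      have "\<bar>?z\<bar> \<le> 1 / \<epsilon>"
        using lip_densities_range[OF uW x] lip_densities_range[OF w x] by simp
      then have "\<bar>?m x - g x\<bar> * \<bar>?z\<bar> \<le> (e * \<epsilon>) * (1 / \<epsilon>)"
        using g(2)[OF x] e eps_pos by (intro mult_mono) auto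
      then have "\<bar>(?m x - g x) * ?z\<bar> \<le> e"
        using eps_pos by (simp only: abs_mult) simp
      then show ?thesis
        by (simp only: left_diff_distrib abs_le_iff)
    qed
    ultimately show "(\<rho>' x - ?\<sigma> x * w x) * (1 - \<epsilon> * w x) \<le>
        ((\<rho>' x - ?\<sigma> x * u x) * (1 - \<epsilon> * u x) + g x * ?z) + e"
      by linarith
  qed
  also have "\<dots> = Q u + (LINT x|unit_lborel. g x * (u x - w x)) + e"
  proof -
    have "integrable unit_lborel (\<lambda>x. (\<rho>' x - ?\<sigma> x * u x) * (1 - \<epsilon> * u x))"
        "integrable unit_lborel (\<lambda>x. g x * (u x - w x))"
      by (intro continuous_unit_integrable continuous_intros \<sigma>c rho'_cont gc lip_densities_continuous uW w)+
    moreover have "(LINT x|unit_lborel. e) = e"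
      by (rule LINT_unit_lborel_const)
    ultimately show ?thesis
      unfolding Q_def by (simp del: LINT_unit_lborel_const Bochner_Integration.lebesgue_integral_const)
  qed
  finally show "Q w \<le> 0 + e"
    using 2 Q_minimizer[OF u(1)] by simp
qed

end

theorem theorem7p1:
  fixes \<rho>0 \<rho>1 \<phi>0 \<phi>1 \<epsilon> :: real
  assumes "0 < \<rho>0" and "\<rho>0 < \<rho>1" and "\<rho>1 < 1"
    and "\<phi>0 = ln (\<rho>0 / (1 - \<rho>0))" and "\<phi>1 = ln (\<rho>1 / (1 - \<rho>1))"
    and "0 < \<epsilon>" and "\<epsilon> < 1 / (\<phi>1 - \<phi>0)"
  shows "(\<forall>\<rho>\<in>smooth_profiles \<rho>0 \<rho>1.
            gateaux_superdiff (quasi_potential \<epsilon> \<phi>0 \<phi>1) \<rho> \<subseteq> H10 \<and>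
            gateaux_subdiff (quasi_potential \<epsilon> \<phi>0 \<phi>1) \<rho> \<subseteq> H10) \<and>
         gateaux_viscosity_solution (Hamiltonian \<epsilon>) (smooth_profiles \<rho>0 \<rho>1)
           (quasi_potential \<epsilon> \<phi>0 \<phi>1)"
proof -
  have less: "\<phi>0 < \<phi>1"
    unfolding assms(4,5) using assms(1-3) by (intro ln_less_cancel_iff[THEN iffD2] frac_less) auto
  have data: "quasi_potential_data \<phi>0 \<phi>1 \<epsilon>"
    using less assms(6,7) by unfold_locales (auto simp: pos_less_divide_eq)
  have "(h \<in> gateaux_superdiff (quasi_potential \<epsilon> \<phi>0 \<phi>1) \<rho> \<longrightarrow> h \<in> H10 \<and> Hamiltonian \<epsilon> \<rho> h \<le> 0) \<and>
        (h \<in> gateaux_subdiff (quasi_potential \<epsilon> \<phi>0 \<phi>1) \<rho> \<longrightarrow> h \<in> H10 \<and> 0 \<le> Hamiltonian \<epsilon> \<rho> h)"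
    if \<rho>: "\<rho> \<in> smooth_profiles \<rho>0 \<rho>1" for \<rho> h
  proof -
    obtain \<rho>' \<rho>'' where d: "\<And>x. x \<in> {0..1} \<Longrightarrow> (\<rho> has_real_derivative \<rho>' x) (at x within {0..1})"
      "\<And>x. x \<in> {0..1} \<Longrightarrow> (\<rho>' has_real_derivative \<rho>'' x) (at x within {0..1})"
      using \<rho> unfolding smooth_profiles_def C2_unit_def by blast
    have r: "\<And>x. x \<in> {0..1} \<Longrightarrow> 0 < \<rho> x \<and> \<rho> x < 1" "\<rho> 0 = \<rho>0" "\<rho> 1 = \<rho>1"
      using \<rho> by (auto simp: smooth_profiles_def)
    have c: "continuous_on {0..1} \<rho>'"
      using DERIV_continuous[OF d(2)] by (simp add: continuous_on_eq_continuous_within)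
    have "smooth_profile \<phi>0 \<phi>1 \<epsilon> \<rho> \<rho>'"
    proof (intro smooth_profile.intro data smooth_profile_axioms.intro)
      show "ln (\<rho> 0) - ln (1 - \<rho> 0) = \<phi>0" "ln (\<rho> 1) - ln (1 - \<rho> 1) = \<phi>1"
        using assms(1-5) by (simp_all add: r(2,3) ln_div)
    qed (use d r c in auto)
    then interpret smooth_profile \<phi>0 \<phi>1 \<epsilon> \<rho> \<rho>' .
    show ?thesis
    proof (intro conjI impI)
      assume h: "h \<in> gateaux_superdiff S \<rho>"
      then have hm: "h \<in> borel_measurable unit_lborel"
        by (auto simp: gateaux_superdiff_def L1_def)
      obtain w where w: "w \<in> lip_densities" "AE x in unit_lborel. h x = \<kappa> x - primitive \<phi>0 w x"
        using superdiff_eq[OF h] .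
      show "h \<in> H10"
        by (rule Hamiltonian_eq_Q(1)[OF w(1) hm w(2)])
      show "Hamiltonian \<epsilon> \<rho> h \<le> 0"
        unfolding Hamiltonian_eq_Q(2)[OF w(1) hm w(2)] by (rule Q_superdiff_le[OF h w])
    next
      assume h: "h \<in> gateaux_subdiff S \<rho>"
      then have hm: "h \<in> borel_measurable unit_lborel"
        by (auto simp: gateaux_subdiff_def L1_def)
      obtain w where m: "minimizer \<rho> w"
        using minimizer_exists[OF rho_profile] by blast
      then have w: "w \<in> lip_densities" by (simp add: minimizer_def)
      note hw = subdiff_eq[OF h m]
      show "h \<in> H10"
        by (rule Hamiltonian_eq_Q(1)[OF w hm hw])
      show "0 \<le> Hamiltonian \<epsilon> \<rho> h"
        unfolding Hamiltonian_eq_Q(2)[OF w hm hw] Q_minimizer[OF m] by simp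
    qed
  qed
  then show ?thesis
    unfolding gateaux_viscosity_solution_def by blast
qed

end
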